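(* Assume: (A1) $\psi$ is proper, closed and convex, $\mathrm{dom}(F)\neq\emptyset$, and $F^\star:=\inf_x F(x)>-\infty$; (A2) $\mathbb{E}_\xi[\|\nabla f_\xi(x)-\nabla f_\xi(y)\|^2]\le L^2\|x-y\|^2$ for all $x,y\in\mathrm{dom}(F)$, with $L\in(0,\infty)$; (A3) $\mathbb{E}_\xi[\|\nabla f_\xi(x)-\nabla f(x)\|^2]\le\sigma^2$ for all $x\in\mathrm{dom}(F)$, with $\sigma\in[0,\infty)$. Let $\{x_t\}_{t=0}^m$ be generated by the ProxHSGD algorithm (see context) to solve $\min_x F(x)$ using the following constant weight and step-sizes: $$\beta_t=\beta:=1-\frac{1}{\sqrt{\tilde b(m+1)}},\qquad \gamma_t=\gamma:=\frac{3}{\sqrt{13}\,[\tilde b(m+1)]^{1/4}},\qquad \eta_t=\eta:=\frac{2}{(3+\gamma)L}.$$ Then the following statements hold: (a) The parameters satisfy $\beta\in(0,1)$, $\gamma\in(0,1)$, and $\frac{1}{2L}\le\eta\le\frac{2}{3L}$. (b) Let the output $\overline{x}_m$ be chosen uniformly at random from $\{x_t\}_{t=0}^m$. Then $$\mathbb{E}\big[\|\mathcal{G}_\eta(\overline{x}_m)\|^2\big]\le\frac{16\sqrt{13}\,L\,\tilde b^{1/4}}{3(m+1)^{3/4}}\,[F(x_0)-F^\star]+\frac{208\,\sigma^2}{9\sqrt{\tilde b(m+1)}}.$$ (c) If we choose $\tilde b:=c_1^2(m+1)^{1/3}$ for some $c_1\ge\frac{1}{(m+1)^{2/3}}$, then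 the bound in (b) reduces to $$\mathbb{E}\big[\|\mathcal{G}_\eta(\overline{x}_m)\|^2\big]\le\frac{\Delta_0}{(m+1)^{2/3}},\qquad \Delta_0:=\frac{16\sqrt{13c_1}\,L}{3}[F(x_0)-F^\star]+\frac{208\sigma^2}{9c_1}.$$ Therefore, for any tolerance $\varepsilon>0$, the number of iterations $m$ to obtain $\overline{x}_m$ such that $\mathbb{E}[\|\mathcal{G}_\eta(\overline{x}_m)\|^2]\le\varepsilon^2$ is at most $$m:=\Big\lfloor \frac{\Delta_0^{3/2}}{\varepsilon^3}\Big\rfloor.$$ This is also the total number of proximal operations $\mathrm{prox}_{\eta\psi}$. In addition, the total number $\mathcal{T}_m$ of stochastic gradient evaluations $\nabla f_\xi(x_t)$ is at most $$\mathcal{T}_m:=\Big\lfloor \frac{c_1^2\Delta_0^{1/2}}{\varepsilon}+\frac{3\Delta_0^{3/2}}{\varepsilon^3}\Big\rfloor.$$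
   Context: Problem: minimize $F(x):=f(x)+\psi(x)$ over $x\in\mathbb{R}^p$, where $f(x)=\mathbb{E}_{\xi\sim\mathbb{P}}[f_\xi(x)]$, each $f_\xi:\mathbb{R}^p\to\mathbb{R}$ is smooth (possibly nonconvex), stochastic gradients are unbiased ($\mathbb{E}_\xi[\nabla f_\xi(x)]=\nabla f(x)$), $\psi:\mathbb{R}^p\to\mathbb{R}\cup\{+\infty\}$, and $\mathrm{dom}(F)=\mathrm{dom}(f)\cap\mathrm{dom}(\psi)$. Proximal operator: $\mathrm{prox}_{\eta\psi}(x):=\arg\min_u\{\eta\psi(u)+\frac12\|u-x\|^2\}$. Gradient mapping: $\mathcal{G}_\eta(x):=\frac1\eta\big(x-\mathrm{prox}_{\eta\psi}(x-\eta\nabla f(x))\big)$. ProxHSGD algorithm (single-sample case): start from an arbitrary initial point $x_0\in\mathrm{dom}(F)$, with input parameters $\tilde b\in\mathbb{N}_+$, $\beta_t\in(0,1)$, $\gamma_t\in(0,1]$, $\eta_t>0$. Generate an unbiased estimator $v_0:=\frac1{\tilde b}\sum_{\tilde\xi_i\in\widetilde{\mathcal{B}}}\nabla f_{\tilde\xi_i}(x_0)$ of $\nabla f(x_0)$ using a mini-batch $\widetilde{\mathcal B}$ of size $\tilde b$; set $\widehat{x}_1:=\mathrm{prox}_{\eta_0\psi}(x_0-\eta_0v_0)$ and $x_1:=(1-\gamma_0)x_0+\gamma_0\widehat{x}_1$. For $t=1,\dots,m$: generate independently a sample pair $(\xi_t,\zeta_t)$ (two independent realizations of $\xi$); set $$v_t:=\beta_{t-1}v_{t-1}+\beta_{t-1}[\nabla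 f_{\xi_t}(x_t)-\nabla f_{\xi_t}(x_{t-1})]+(1-\beta_{t-1})\nabla f_{\zeta_t}(x_t);$$ set $\widehat{x}_{t+1}:=\mathrm{prox}_{\eta_t\psi}(x_t-\eta_tv_t)$ and $x_{t+1}:=(1-\gamma_t)x_t+\gamma_t\widehat{x}_{t+1}$. $\mathbb{E}[\cdot]$ is expectation over all randomness, including the random choice of $\overline{x}_m$.
   Formalization: In (c), m=⌊Δ₀^{3/2}/ε³⌋ gives accuracy and the main-loop prox count; total prox and gradient counts (false there) are shown, with accuracy, for m+1=⌊Δ₀^{3/2}/ε³⌋. Assumed: b̃(m+1)>1, f_ξ is C¹, dom f open, f differentiable on it. *)

theory Defs
  imports "HOL-Probability.Probability"
begin

definition edom :: "('a \<Rightarrow> ereal) \<Rightarrow> 'a set" where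
  "edom h = {x. h x < \<infinity>}"

definition epi :: "('a \<Rightarrow> ereal) \<Rightarrow> ('a \<times> real) set" where
  "epi h = {(x, r). h x \<le> ereal r}"

definition proper_fun :: "('a \<Rightarrow> ereal) \<Rightarrow> bool" where
  "proper_fun h \<longleftrightarrow> (\<forall>x. h x \<noteq> -\<infinity>) \<and> edom h \<noteq> {}"

definition closed_fun :: "('a::topological_space \<Rightarrow> ereal) \<Rightarrow> bool" where
  "closed_fun h \<longleftrightarrow> closed (epi h)"

definition convex_fun :: "('a::real_vector \<Rightarrow> ereal) \<Rightarrow> bool" where
  "convex_fun h \<longleftrightarrow> convex (epi h)"

definition grad :: "('a::real_inner \<Rightarrow> real) \<Rightarrow> 'a \<Rightarrow> 'a" where
  "grad h x = (THE D. GDERIV h x :> D)"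

text \<open>The Bochner integral is 0 for non-integrable functions, so the mean of the random function
  is made \<open>+\<infinity>\<close> where it does not exist; its effective domain is the set where it does.\<close>

definition mean_fun :: "'s measure \<Rightarrow> ('s \<Rightarrow> 'a \<Rightarrow> real) \<Rightarrow> 'a \<Rightarrow> ereal" where
  "mean_fun P fs x =
     (if integrable P (\<lambda>s. fs s x) then ereal (\<integral>s. fs s x \<partial>P) else \<infinity>)"

text \<open>For proper closed convex \<open>\<psi>\<close> and \<open>\<eta> > 0\<close> the minimizer exists and is unique, so the choice
  made by \<open>ARG_MIN\<close> is immaterial.\<close>

definition prox :: "real \<Rightarrow> ('a::real_normed_vector \<Rightarrow> ereal) \<Rightarrow> 'a \<Rightarrow> 'a" where
  "prox \<eta> \<psi> x = (ARG_MIN (\<lambda>u. ereal \<eta> * \<psi> u + ereal ((norm (u - x))\<^sup>2 / 2)) u. True)"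

definition grad_mapping ::
    "real \<Rightarrow> ('a::real_normed_vector \<Rightarrow> ereal) \<Rightarrow> ('a \<Rightarrow> 'a) \<Rightarrow> 'a \<Rightarrow> 'a" where
  "grad_mapping \<eta> \<psi> g x = (1 / \<eta>) *\<^sub>R (x - prox \<eta> \<psi> (x - \<eta> *\<^sub>R g x))"

text \<open>Names of the samples drawn during a run: the members of the initial mini-batch, and the pair
  \<open>(\<xi>\<^sub>t, \<zeta>\<^sub>t)\<close> of iteration \<open>t\<close>.\<close>

datatype hsgd_sample = Batch nat | Xi nat | Zeta nat

definition hsgd_samples :: "nat \<Rightarrow> nat \<Rightarrow> hsgd_sample set" where
  "hsgd_samples b m = Batch ` {..<b} \<union> Xi ` {1..m} \<union> Zeta ` {1..m}"

text \<open>State at the end of iteration \<open>t\<close> (\<open>t = 0\<close> being the initial step): \<open>x\<^sub>t\<close>, \<open>x\<^sub>t\<^sub>+\<^sub>1\<close>, \<open>v\<^sub>t\<close>, and the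
  cumulative numbers of proximal operations and of stochastic gradient evaluations performed.\<close>

record 'a hsgd_state =
  iterate :: 'a
  next_iterate :: 'a
  estimator :: 'a
  prox_calls :: nat
  grad_calls :: nat

text \<open>\<open>w\<close> is a realization of the samples; \<open>g s x\<close> is the stochastic gradient at \<open>x\<close> for sample
  value \<open>s\<close>.\<close>

primrec proxHSGD ::
    "('s \<Rightarrow> 'a::real_normed_vector \<Rightarrow> 'a) \<Rightarrow> ('a \<Rightarrow> ereal) \<Rightarrow> nat \<Rightarrow>
     (nat \<Rightarrow> real) \<Rightarrow> (nat \<Rightarrow> real) \<Rightarrow> (nat \<Rightarrow> real) \<Rightarrow> 'a \<Rightarrow>
     (hsgd_sample \<Rightarrow> 's) \<Rightarrow> nat \<Rightarrow> 'a hsgd_state" where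
  "proxHSGD g \<psi> b \<beta> \<gamma> \<eta> x0 w 0 =
     (let v = (1 / real b) *\<^sub>R (\<Sum>i<b. g (w (Batch i)) x0);
          xhat = prox (\<eta> 0) \<psi> (x0 - \<eta> 0 *\<^sub>R v)
      in \<lparr> iterate = x0,
           next_iterate = (1 - \<gamma> 0) *\<^sub>R x0 + \<gamma> 0 *\<^sub>R xhat,
           estimator = v,
           prox_calls = 1,
           grad_calls = b \<rparr>)"
| "proxHSGD g \<psi> b \<beta> \<gamma> \<eta> x0 w (Suc t) =
     (let st = proxHSGD g \<psi> b \<beta> \<gamma> \<eta> x0 w t;
          xprev = iterate st;
          x = next_iterate st;
          v = \<beta> t *\<^sub>R estimator st
              + \<beta> t *\<^sub>R (g (w (Xi (Suc t))) x - g (w (Xi (Suc t))) xprev)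
              + (1 - \<beta> t) *\<^sub>R g (w (Zeta (Suc t))) x;
          xhat = prox (\<eta> (Suc t)) \<psi> (x - \<eta> (Suc t) *\<^sub>R v)
      in \<lparr> iterate = x,
           next_iterate = (1 - \<gamma> (Suc t)) *\<^sub>R x + \<gamma> (Suc t) *\<^sub>R xhat,
           estimator = v,
           prox_calls = prox_calls st + 1,
           grad_calls = grad_calls st + 3 \<rparr>)"

end

theory Submission
  imports Defs
begin

text \<open>Let \<open>e\<^sub>t = v\<^sub>t - \<nabla>f(x\<^sub>t)\<close> and \<open>d\<^sub>t = prox(x\<^sub>t - \<eta> v\<^sub>t) - x\<^sub>t\<close>. Smoothness of \<open>f\<close> and the optimality
  condition of the proximal step bound \<open>\<Sum> (c\<^sub>1 |\<G>(x\<^sub>t)|\<^sup>2 + c\<^sub>2 |d\<^sub>t|\<^sup>2)\<close> by \<open>F(x\<^sub>0) - F\<^sup>\<star> + c\<^sub>3 \<Sum> |e\<^sub>t|\<^sup>2\<close>,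
  surely. The two fresh samples of an iteration are independent of the past and have centred
  contributions to \<open>e\<^sub>t\<^sub>+\<^sub>1\<close>, whence
  \<open>E|e\<^sub>t\<^sub>+\<^sub>1|\<^sup>2 \<le> \<beta>\<^sup>2 E|e\<^sub>t|\<^sup>2 + \<beta>\<^sup>2 L\<^sup>2 \<gamma>\<^sup>2 E|d\<^sub>t|\<^sup>2 + (1 - \<beta>)\<^sup>2 \<sigma>\<^sup>2\<close>. Summing this recursion, the choice
  \<open>\<gamma>\<^sup>2 = 9 (1 - \<beta>) / 13\<close> makes the \<open>d\<^sub>t\<close> terms of the first bound absorb those of the second.\<close>

section \<open>Proximal operator\<close>

text \<open>Two obstacles shape the proof. First, (A2) and (A3) speak about dom F only, while a
  proximal step is only known to land in dom \<psi>; that dom \<psi> lies in dom f has to be derived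
  before they can be applied to an iterate. Second, no moment of the iterates is known in advance.
  The recursion for the errors is therefore proved in nonnegative integrals, and square
  integrability comes out of an induction that alternates between errors and steps. Conditioning on
  the past becomes redrawing one coordinate of the product space of samples, which preserves its
  law. The Lipschitz constant of the gradient of f also comes from (A2), because a second moment
  dominates the square of the mean. In part (c) the number of iterations is read both as m and as m
  + 1; the second reading forces constants sharper than those claimed in (b) and a separate argument
  for m = 0.\<close>

lemma ereal_of_edom:
  assumes "proper_fun h" "x \<in> edom h"
  shows "ereal (real_of_ereal (h x)) = h x"
  using assms by (cases "h x") (auto simp: proper_fun_def edom_def)

lemma edom_iff_epi: "x \<in> edom h \<longleftrightarrow> (\<exists>r. (x, r) \<in> epi h)"
proof
  assume "x \<in> edom h"
  then show "\<exists>r. (x, r) \<in> epi h"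
    by (cases "h x") (auto simp: edom_def epi_def)
qed (auto simp: edom_def epi_def)

lemma convex_edom:
  assumes "convex_fun h"
  shows "convex (edom h)"
proof (rule convexI)
  fix x y and u v :: real
  assume "x \<in> edom h" "y \<in> edom h" and uv: "0 \<le> u" "0 \<le> v" "u + v = 1"
  then obtain r s where "(x, r) \<in> epi h" "(y, s) \<in> epi h"
    by (auto simp: edom_iff_epi)
  with assms uv have "u *\<^sub>R (x, r) + v *\<^sub>R (y, s) \<in> epi h"
    unfolding convex_fun_def by (intro convexD)
  then show "u *\<^sub>R x + v *\<^sub>R y \<in> edom h"
    by (auto simp: edom_iff_epi)
qed

lemma convex_fun_real_le:
  assumes "proper_fun h" "convex_fun h" "x \<in> edom h" "y \<in> edom h"
    and t: "0 \<le> t" "t \<le> (1::real)"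
  shows "real_of_ereal (h ((1 - t) *\<^sub>R x + t *\<^sub>R y))
    \<le> (1 - t) * real_of_ereal (h x) + t * real_of_ereal (h y)"
proof -
  have "(x, real_of_ereal (h x)) \<in> epi h" "(y, real_of_ereal (h y)) \<in> epi h"
    using assms by (auto simp: epi_def ereal_of_edom)
  then have "(1 - t) *\<^sub>R (x, real_of_ereal (h x)) + t *\<^sub>R (y, real_of_ereal (h y)) \<in> epi h"
    using assms unfolding convex_fun_def by (intro convexD) auto
  then have le: "h ((1 - t) *\<^sub>R x + t *\<^sub>R y)
      \<le> ereal ((1 - t) * real_of_ereal (h x) + t * real_of_ereal (h y))"
    by (auto simp: epi_def)
  then have "(1 - t) *\<^sub>R x + t *\<^sub>R y \<in> edom h"
    by (auto simp: edom_def)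
  from ereal_of_edom[OF assms(1) this] le show ?thesis
    by (metis ereal_less_eq(3))
qed

text \<open>Separates the closed convex epigraph from a point one unit below the graph. An affine
  lower bound is outgrown by the quadratic of the proximal objective, which makes that objective
  coercive.\<close>

lemma closed_convex_affine_minorant:
  fixes h :: "'a::euclidean_space \<Rightarrow> ereal"
  assumes "proper_fun h" "closed_fun h" "convex_fun h"
  obtains p c where "\<And>x r. (x, r) \<in> epi h \<Longrightarrow> p \<bullet> x + c \<le> r"
proof -
  obtain z where z: "z \<in> edom h"
    using assms(1) by (auto simp: proper_fun_def)
  define q where "q = real_of_ereal (h z)"
  have hz: "h z = ereal q"
    using ereal_of_edom[OF assms(1) z] by (simp add: q_def)
  have "(z, q - 1) \<notin> epi h" "(z, q) \<in> epi h"
    by (auto simp: epi_def hz)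
  from separating_hyperplane_closed_point[of "epi h" "(z, q - 1)"] this(1) assms(2,3)
  obtain a k where a: "a \<bullet> (z, q - 1) < k" "\<And>y. y \<in> epi h \<Longrightarrow> a \<bullet> y > k"
    unfolding closed_fun_def convex_fun_def by blast
  obtain a1 a2 where [simp]: "a = (a1, a2)" by (cases a)
  \<comment> \<open>Both points lie over \<open>z\<close> and the hyperplane passes strictly between
    them, so it is not vertical and can be solved for the last coordinate.\<close>
  have "a2 > 0"
    using a(1) a(2)[OF \<open>(z, q) \<in> epi h\<close>] by (simp add: algebra_simps)
  show ?thesis
  proof (rule that[of "(- 1 / a2) *\<^sub>R a1" "k / a2"])
    fix x r assume "(x, r) \<in> epi h"
    from a(2)[OF this] have "k < a1 \<bullet> x + a2 * r" by simp
    with \<open>a2 > 0\<close> show "((- 1 / a2) *\<^sub>R a1) \<bullet> x + k / a2 \<le> r"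
      by (simp add: field_simps)
  qed
qed

lemma prox_attained:
  fixes \<psi> :: "'a::euclidean_space \<Rightarrow> ereal"
  assumes \<psi>: "proper_fun \<psi>" "closed_fun \<psi>" "convex_fun \<psi>" and "\<eta> > 0"
  shows "\<exists>u\<in>edom \<psi>. \<forall>y\<in>edom \<psi>. \<eta> * real_of_ereal (\<psi> u) + (norm (u - x))\<^sup>2 / 2
      \<le> \<eta> * real_of_ereal (\<psi> y) + (norm (y - x))\<^sup>2 / 2"
proof -
  obtain z where z: "z \<in> edom \<psi>"
    using \<psi>(1) by (auto simp: proper_fun_def)
  obtain p c where minor: "\<And>x r. (x, r) \<in> epi \<psi> \<Longrightarrow> p \<bullet> x + c \<le> r"
    using closed_convex_affine_minorant[OF \<psi>] by blast
  \<comment> \<open>The minimization moves to the epigraph: there the value of \<psi> is a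
    coordinate, so \<open>H\<close> is continuous although \<psi> is only lower semicontinuous, and
    sublevel sets within \<open>epi \<psi>\<close> are closed.\<close>
  define H where "H = (\<lambda>w::'a \<times> real. \<eta> * snd w + (norm (fst w - x))\<^sup>2 / 2)"
  have cont: "continuous_on S H" for S
    unfolding H_def by (intro continuous_intros) auto
  have graph: "(y, real_of_ereal (\<psi> y)) \<in> epi \<psi>" if "y \<in> edom \<psi>" for y
    using ereal_of_edom[OF \<psi>(1) that] by (simp add: epi_def)
  define K where "K = H (z, real_of_ereal (\<psi> z))"
  define C where "C = epi \<psi> \<inter> {w. H w \<le> K}"
  have "closed C"
    unfolding C_def using \<psi>(2) cont
    by (intro closed_Int closed_Collect_le continuous_on_const) (auto simp: closed_fun_def)
  moreover have "bounded C"
  proof -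
    \<comment> \<open>On \<open>C\<close> the distance n to \<open>x\<close> satisfies n^2 / 2 <= a
      n + k with a = \<open>\<eta> * norm p\<close>. For n > R = 4 a + 4 |k| + 1 one would have 4 (a
      n + k) < n^2, which contradicts this.\<close>
    define R where "R = 4 * \<eta> * norm p + \<bar>4 * (K - \<eta> * (p \<bullet> x) - \<eta> * c)\<bar> + 1"
    have R: "norm (u - x) \<le> R \<and> r \<le> K / \<eta> \<and> - norm p * (norm x + R) + c \<le> r"
      if "(u, r) \<in> C" for u r
    proof -
      have ur: "(u, r) \<in> epi \<psi>" "\<eta> * r + (norm (u - x))\<^sup>2 / 2 \<le> K"
        using that by (auto simp: C_def H_def)
      have pu: "- (norm p * norm (u - x)) \<le> p \<bullet> u - p \<bullet> x"
        using Cauchy_Schwarz_ineq2[of p "u - x"] by (simp add: inner_diff_right)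
      have "\<eta> * (p \<bullet> u + c) \<le> \<eta> * r"
        using minor[OF ur(1)] \<open>\<eta> > 0\<close> by simp
      moreover have "\<eta> * (p \<bullet> x - norm p * norm (u - x) + c) \<le> \<eta> * (p \<bullet> u + c)"
        using pu \<open>\<eta> > 0\<close> by simp
      ultimately have q: "(norm (u - x))\<^sup>2 / 2 \<le> (\<eta> * norm p) * norm (u - x) + (K - \<eta> * (p \<bullet> x) - \<eta> * c)"
        using ur(2) by (simp add: algebra_simps)
      have le: "norm (u - x) \<le> R"
      proof (rule ccontr)
        assume "\<not> ?thesis"
        then have big: "R < norm (u - x)" by simp
        let ?n = "norm (u - x)"
        have nn: "0 \<le> \<eta> * norm p" using \<open>\<eta> > 0\<close> by simp
        have "1 \<le> ?n" using big nn unfolding R_def by linarith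
        have "4 * (\<eta> * norm p) * ?n + \<bar>4 * (K - \<eta> * (p \<bullet> x) - \<eta> * c)\<bar> * 1
            \<le> 4 * (\<eta> * norm p) * ?n + \<bar>4 * (K - \<eta> * (p \<bullet> x) - \<eta> * c)\<bar> * ?n"
          using \<open>1 \<le> ?n\<close> by (intro add_left_mono mult_left_mono) auto
        also have "\<dots> = (4 * (\<eta> * norm p) + \<bar>4 * (K - \<eta> * (p \<bullet> x) - \<eta> * c)\<bar>) * ?n"
          by (simp add: algebra_simps)
        also have "\<dots> < ?n * ?n"
          using big \<open>1 \<le> ?n\<close> unfolding R_def by (intro mult_strict_right_mono) auto
        finally have "4 * (\<eta> * norm p * ?n) + 4 * (K - \<eta> * (p \<bullet> x) - \<eta> * c) < ?n\<^sup>2"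
          by (simp add: power2_eq_square algebra_simps)
        moreover have "0 \<le> ?n\<^sup>2" by simp
        ultimately show False using q by (simp add: algebra_simps)
      qed
      have "\<eta> * r \<le> K" using ur(2) by (smt (verit) zero_le_power2 divide_nonneg_pos)
      then have "r \<le> K / \<eta>" using \<open>\<eta> > 0\<close> by (simp add: field_simps)
      moreover have "- (norm p * (norm x + R)) \<le> p \<bullet> u"
      proof -
        have "norm u \<le> norm x + R" using le norm_triangle_sub[of u x] by linarith
        then have "norm p * norm u \<le> norm p * (norm x + R)" by (intro mult_left_mono) auto
        then show ?thesis using Cauchy_Schwarz_ineq2[of p u] by linarith
      qed
      ultimately show ?thesis using le minor[OF ur(1)] by simp
    qed
    have "C \<subseteq> cball x R \<times> {- norm p * (norm x + R) + c .. K / \<eta>}"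
      using R by (auto simp: dist_norm norm_minus_commute)
    then show ?thesis
      by (rule bounded_subset[rotated]) (intro bounded_Times bounded_cball bounded_closed_interval)
  qed
  ultimately have "compact C" by (simp add: compact_eq_bounded_closed)
  moreover have zC: "(z, real_of_ereal (\<psi> z)) \<in> C"
    using graph[OF z] by (simp add: C_def K_def)
  ultimately obtain w where w: "w \<in> C" "\<And>w'. w' \<in> C \<Longrightarrow> H w \<le> H w'"
    using continuous_attains_inf[of C H] cont by blast
  have wmin: "H w \<le> H w'" if "w' \<in> epi \<psi>" for w'
    using that w(2)[of w'] w(2)[OF zC] by (cases "H w' \<le> K") (auto simp: C_def K_def)
  obtain u r where [simp]: "w = (u, r)" by (cases w)
  have ud: "u \<in> edom \<psi>" "\<psi> u \<le> ereal r"
    using w(1) by (auto simp: C_def edom_def epi_def)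
  then have "real_of_ereal (\<psi> u) \<le> r"
    using ereal_of_edom[OF \<psi>(1) ud(1)] by (metis ereal_less_eq(3))
  then have "\<eta> * real_of_ereal (\<psi> u) \<le> \<eta> * r" using \<open>\<eta> > 0\<close> by simp
  moreover have "H (u, r) \<le> \<eta> * real_of_ereal (\<psi> y) + (norm (y - x))\<^sup>2 / 2" if "y \<in> edom \<psi>" for y
    using wmin[OF graph[OF that]] by (simp add: H_def)
  ultimately show ?thesis
    using ud(1) by (intro bexI[of _ u]) (force simp: H_def)+
qed

lemma
  fixes \<psi> :: "'a::euclidean_space \<Rightarrow> ereal"
  assumes \<psi>: "proper_fun \<psi>" "closed_fun \<psi>" "convex_fun \<psi>" and "\<eta> > 0"
  shows prox_in_edom: "prox \<eta> \<psi> x \<in> edom \<psi>"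
    and prox_minimizes: "y \<in> edom \<psi> \<Longrightarrow>
      \<eta> * real_of_ereal (\<psi> (prox \<eta> \<psi> x)) + (norm (prox \<eta> \<psi> x - x))\<^sup>2 / 2
      \<le> \<eta> * real_of_ereal (\<psi> y) + (norm (y - x))\<^sup>2 / 2"
proof -
  define H where "H = (\<lambda>u. ereal \<eta> * \<psi> u + ereal ((norm (u - x))\<^sup>2 / 2))"
  have Hr: "H y = ereal (\<eta> * real_of_ereal (\<psi> y) + (norm (y - x))\<^sup>2 / 2)" if "y \<in> edom \<psi>" for y
    unfolding H_def by (subst ereal_of_edom[OF \<psi>(1) that, symmetric]) simp
  have Hinf: "H y = \<infinity>" if "y \<notin> edom \<psi>" for y
    using that \<open>\<eta> > 0\<close> by (simp add: H_def edom_def)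
  from prox_attained[OF assms] obtain u where u: "u \<in> edom \<psi>"
    "\<And>y. y \<in> edom \<psi> \<Longrightarrow> \<eta> * real_of_ereal (\<psi> u) + (norm (u - x))\<^sup>2 / 2
      \<le> \<eta> * real_of_ereal (\<psi> y) + (norm (y - x))\<^sup>2 / 2" by blast
  then have "H u \<le> H y" for y
    by (cases "y \<in> edom \<psi>") (auto simp: Hr Hinf)
  then have "is_arg_min H (\<lambda>_. True) u"
    by (auto simp: is_arg_min_def not_less)
  \<comment> \<open>\<open>ARG_MIN\<close> is a Hilbert choice: one minimizer suffices for the
    chosen point to be a minimizer.\<close>
  then have "is_arg_min H (\<lambda>_. True) (prox \<eta> \<psi> x)"
    unfolding prox_def H_def arg_min_def by (rule someI)
  then have le: "H (prox \<eta> \<psi> x) \<le> H y" for y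
    by (auto simp: is_arg_min_def not_less)
  show dom: "prox \<eta> \<psi> x \<in> edom \<psi>"
    using le[of u] Hr[OF u(1)] Hinf[of "prox \<eta> \<psi> x"] by (cases "prox \<eta> \<psi> x \<in> edom \<psi>") auto
  show "\<eta> * real_of_ereal (\<psi> (prox \<eta> \<psi> x)) + (norm (prox \<eta> \<psi> x - x))\<^sup>2 / 2
      \<le> \<eta> * real_of_ereal (\<psi> y) + (norm (y - x))\<^sup>2 / 2" if "y \<in> edom \<psi>"
    using le[of y] Hr[OF that] Hr[OF dom] by simp
qed

text \<open>First-order optimality: with u the proximal point, (x - u) / \<eta> is a subgradient of
  \<psi> at u. In the comparison of u with (1 - t) u + t y, convexity bounds the change of \<psi>
  linearly in t; dividing by t and letting t tend to 0 removes the quadratic remainder.\<close>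

lemma prox_variational:
  fixes \<psi> :: "'a::euclidean_space \<Rightarrow> ereal"
  assumes \<psi>: "proper_fun \<psi>" "closed_fun \<psi>" "convex_fun \<psi>" and "\<eta> > 0"
    and y: "y \<in> edom \<psi>"
  shows "\<eta> * real_of_ereal (\<psi> (prox \<eta> \<psi> x)) + (x - prox \<eta> \<psi> x) \<bullet> (y - prox \<eta> \<psi> x)
    \<le> \<eta> * real_of_ereal (\<psi> y)"
proof -
  define u where "u = prox \<eta> \<psi> x"
  let ?r = "\<lambda>z. real_of_ereal (\<psi> z)"
  have u: "u \<in> edom \<psi>" unfolding u_def by (rule prox_in_edom[OF assms(1-4)])
  have *: "\<eta> * ?r u + (x - u) \<bullet> (y - u) - \<eta> * ?r y \<le> t * ((norm (y - u))\<^sup>2 / 2)"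
    if t: "0 < t" "t \<le> 1" for t
  proof -
    let ?z = "(1 - t) *\<^sub>R u + t *\<^sub>R y"
    have z: "?z \<in> edom \<psi>"
      using convexD[OF convex_edom[OF \<psi>(3)] u y] t by auto
    have "\<eta> * ?r u + (norm (u - x))\<^sup>2 / 2 \<le> \<eta> * ?r ?z + (norm (?z - x))\<^sup>2 / 2"
      using prox_minimizes[OF assms(1-4) z, of x] by (simp add: u_def)
    moreover have "\<eta> * ?r ?z \<le> \<eta> * ((1 - t) * ?r u + t * ?r y)"
      using convex_fun_real_le[OF \<psi>(1,3) u y] t \<open>\<eta> > 0\<close> by simp
    moreover have "(norm (?z - x))\<^sup>2 = (norm (u - x))\<^sup>2 - 2 * t * ((x - u) \<bullet> (y - u)) + t\<^sup>2 * (norm (y - u))\<^sup>2"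
    proof -
      have "?z - x = (u - x) + t *\<^sub>R (y - u)" by (simp add: algebra_simps)
      then show ?thesis
        by (simp only: power2_norm_eq_inner)
          (simp add: algebra_simps inner_commute power2_eq_square)
    qed
    ultimately have "t * (\<eta> * ?r u + (x - u) \<bullet> (y - u) - \<eta> * ?r y) \<le> t * (t * ((norm (y - u))\<^sup>2 / 2))"
      by (simp add: algebra_simps power2_eq_square)
    with t show ?thesis by simp
  qed
  have "((\<lambda>t. t * ((norm (y - u))\<^sup>2 / 2)) \<longlongrightarrow> 0 * ((norm (y - u))\<^sup>2 / 2)) (at_right 0)"
    by (intro tendsto_intros)
  moreover have "eventually (\<lambda>t. \<eta> * ?r u + (x - u) \<bullet> (y - u) - \<eta> * ?r y \<le> t * ((norm (y - u))\<^sup>2 / 2)) (at_right 0)"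
    by (rule eventually_mono[OF eventually_at_right_real[of 0 1]]) (simp, intro *, auto)
  ultimately have "\<eta> * ?r u + (x - u) \<bullet> (y - u) - \<eta> * ?r y \<le> 0 * ((norm (y - u))\<^sup>2 / 2)"
    by (rule tendsto_lowerbound) simp
  then show ?thesis by (simp add: u_def)
qed

text \<open>Each proximal point is tested in the variational inequality of the other. The sum
  expresses monotonicity of the subdifferential, and Cauchy-Schwarz finishes.\<close>

lemma prox_nonexpansive:
  fixes \<psi> :: "'a::euclidean_space \<Rightarrow> ereal"
  assumes \<psi>: "proper_fun \<psi>" "closed_fun \<psi>" "convex_fun \<psi>" and "\<eta> > 0"
  shows "norm (prox \<eta> \<psi> x - prox \<eta> \<psi> y) \<le> norm (x - y)"
proof -
  define u v where "u = prox \<eta> \<psi> x" "v = prox \<eta> \<psi> y"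
  have "(x - u) \<bullet> (v - u) + (y - v) \<bullet> (u - v) \<le> 0"
    using prox_variational[OF assms prox_in_edom[OF assms], of x y]
      prox_variational[OF assms prox_in_edom[OF assms], of y x]
    by (simp add: u_v_def)
  then have "(u - v) \<bullet> (u - v) \<le> (x - y) \<bullet> (u - v)"
    by (simp add: algebra_simps inner_commute)
  also have "\<dots> \<le> norm (x - y) * norm (u - v)"
    by (rule norm_cauchy_schwarz)
  finally have "norm (u - v) * norm (u - v) \<le> norm (x - y) * norm (u - v)"
    by (simp add: power2_norm_eq_inner[symmetric] power2_eq_square)
  then have "norm (u - v) \<le> norm (x - y)"
    by (cases "u = v") auto
  then show ?thesis by (simp add: u_v_def)
qed

lemma borel_measurable_prox:
  fixes \<psi> :: "'a::euclidean_space \<Rightarrow> ereal"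
  assumes "proper_fun \<psi>" "closed_fun \<psi>" "convex_fun \<psi>" "\<eta> > 0"
  shows "prox \<eta> \<psi> \<in> borel_measurable borel"
proof (rule borel_measurable_continuous_onI)
  have "1-lipschitz_on UNIV (prox \<eta> \<psi>)"
    using prox_nonexpansive[OF assms] by (intro lipschitz_onI) (auto simp: dist_norm)
  then show "continuous_on UNIV (prox \<eta> \<psi>)" by (rule lipschitz_on_continuous_on)
qed

section \<open>Gradients, measurability and variance\<close>

text \<open>\<open>grad\<close> is a definite description, so the Riesz representative of the
  derivative must exist and be unique; its coordinates are the values of the derivative on
  \<open>Basis\<close>.\<close>

lemma GDERIV_grad:
  fixes h :: "'a::euclidean_space \<Rightarrow> real"
  assumes "h differentiable (at x)"
  shows "GDERIV h x :> grad h x"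
proof -
  obtain h' where h': "(h has_derivative h') (at x)"
    using assms by (auto simp: differentiable_def)
  interpret h': bounded_linear h' using h' by (rule has_derivative_bounded_linear)
  define D where "D = (\<Sum>i\<in>Basis. h' i *\<^sub>R i)"
  have "h' = (\<lambda>y. y \<bullet> D)"
  proof
    fix y
    have "h' y = h' (\<Sum>i\<in>Basis. (y \<bullet> i) *\<^sub>R i)" by (simp add: euclidean_representation)
    also have "\<dots> = y \<bullet> D"
      by (simp add: D_def h'.sum h'.scaleR inner_sum_right mult.commute)
    finally show "h' y = y \<bullet> D" .
  qed
  with h' have D: "GDERIV h x :> D" by (simp add: gderiv_def)
  have "D' = D" if "GDERIV h x :> D'" for D'
  proof -
    have "(\<lambda>y. y \<bullet> D') = (\<lambda>y. y \<bullet> D)"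
      using that D unfolding gderiv_def by (rule has_derivative_unique)
    then have "y \<bullet> D' = y \<bullet> D" for y by meson
    then show ?thesis by (metis inner_commute vector_eq_rdot)
  qed
  with D show ?thesis unfolding grad_def by (rule theI)
qed

lemma DERIV_grad_line:
  fixes h :: "'a::euclidean_space \<Rightarrow> real"
  assumes "h differentiable (at (x + t *\<^sub>R d))"
  shows "((\<lambda>t. h (x + t *\<^sub>R d)) has_real_derivative grad h (x + t *\<^sub>R d) \<bullet> d) (at t)"
proof -
  have "((\<lambda>t. x + t *\<^sub>R d) has_derivative (\<lambda>s. s *\<^sub>R d)) (at t)"
    by (auto intro!: derivative_eq_intros)
  moreover have "(h has_derivative (\<lambda>y. y \<bullet> grad h (x + t *\<^sub>R d))) (at (x + t *\<^sub>R d))"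
    using GDERIV_grad[OF assms] by (simp add: gderiv_def)
  ultimately have "((\<lambda>t. h (x + t *\<^sub>R d)) has_derivative (\<lambda>s. (s *\<^sub>R d) \<bullet> grad h (x + t *\<^sub>R d))) (at t)"
    by (rule has_derivative_compose)
  moreover have "(\<lambda>s. (s *\<^sub>R d) \<bullet> grad h (x + t *\<^sub>R d)) = (*) (grad h (x + t *\<^sub>R d) \<bullet> d)"
    by (auto simp: fun_eq_iff inner_commute)
  ultimately show ?thesis
    by (simp add: has_field_derivative_def)
qed

text \<open>Each coordinate is a limit of difference quotients with increments 1 / (n + 1), which
  are measurable in the sample.\<close>

lemma borel_measurable_grad:
  fixes h :: "'s \<Rightarrow> 'a::euclidean_space \<Rightarrow> real"
  assumes meas: "\<And>x. (\<lambda>s. h s x) \<in> borel_measurable P"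
    and diff: "\<And>s. s \<in> space P \<Longrightarrow> h s differentiable (at x)"
  shows "(\<lambda>s. grad (h s) x) \<in> borel_measurable P"
proof -
  have "(\<lambda>s. grad (h s) x \<bullet> i) \<in> borel_measurable P" for i
  proof (rule borel_measurable_LIMSEQ_real)
    show "(\<lambda>s. (h s (x + inverse (real (Suc n)) *\<^sub>R i) - h s x) / inverse (real (Suc n)))
        \<in> borel_measurable P" for n
      using meas by measurable
    fix s assume "s \<in> space P"
    then have "((\<lambda>t. h s (x + t *\<^sub>R i)) has_real_derivative grad (h s) x \<bullet> i) (at 0)"
      using DERIV_grad_line[of "h s" x 0 i] diff by simp
    then have "((\<lambda>t. (h s (x + t *\<^sub>R i) - h s x) / t) \<longlongrightarrow> grad (h s) x \<bullet> i) (at 0)"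
      by (simp add: DERIV_def)
    moreover have "filterlim (\<lambda>n. inverse (real (Suc n))) (at 0) sequentially"
      by (intro filterlim_atI LIMSEQ_inverse_real_of_nat always_eventually) simp
    ultimately show "(\<lambda>n. (h s (x + inverse (real (Suc n)) *\<^sub>R i) - h s x) / inverse (real (Suc n)))
        \<longlonglongrightarrow> grad (h s) x \<bullet> i"
      by (rule filterlim_compose)
  qed
  then show ?thesis by (subst borel_measurable_euclidean_space) blast
qed

text \<open>If the point is replaced by a simple function of it, only finitely many sections occur;
  continuity in the point carries measurability to the limit. Joint measurability matters because
  gradients are evaluated at random iterates.\<close>

lemma borel_measurable_Caratheodory:
  fixes g :: "'s \<Rightarrow> 'a::{metric_space, second_countable_topology} \<Rightarrow> 'b::metric_space"
  assumes meas: "\<And>x. (\<lambda>s. g s x) \<in> borel_measurable P"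
    and cont: "\<And>s. s \<in> space P \<Longrightarrow> continuous_on UNIV (g s)"
  shows "(\<lambda>w. g (fst w) (snd w)) \<in> borel_measurable (P \<Otimes>\<^sub>M borel)"
proof -
  obtain q :: "nat \<Rightarrow> 'a \<Rightarrow> 'a" where q: "\<And>i. simple_function borel (q i)"
      "\<And>x. (\<lambda>i. q i x) \<longlonglongrightarrow> x"
    using borel_measurable_implies_sequence_metric[of "\<lambda>x::'a. x" borel] by simp blast
  show ?thesis
  proof (rule borel_measurable_LIMSEQ_metric)
    fix i
    have "finite (range (q i))"
      using simple_functionD(1)[OF q(1)] by simp
    moreover have "q i \<in> measurable borel (count_space (range (q i)))"
      using q(1)[of i] by (auto simp: simple_function_def measurable_count_space_eq2)
    ultimately show "(\<lambda>w. g (fst w) (q i (snd w))) \<in> borel_measurable (P \<Otimes>\<^sub>M borel)"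
      by (intro measurable_compose_countable'[where f="\<lambda>x w. g (fst w) x"
            and g="\<lambda>w. q i (snd w)" and I="range (q i)"])
        (auto intro!: measurable_compose[OF measurable_fst meas] measurable_compose[OF measurable_snd]
          countable_finite)
  next
    fix w assume "w \<in> space (P \<Otimes>\<^sub>M (borel :: 'a measure))"
    then have "continuous_on UNIV (g (fst w))"
      by (auto simp: space_pair_measure intro: cont)
    then show "(\<lambda>i. g (fst w) (q i (snd w))) \<longlonglongrightarrow> g (fst w) (snd w)"
      using q(2) by (intro isCont_tendsto_compose[of _ "g (fst w)"]) (auto simp: continuous_on_eq_continuous_at)
  qed
qed

section \<open>Second moments of centred noise, and redrawing one sample\<close>

lemma (in prob_space) nn_integral_noise_le:
  fixes Z :: "'a \<Rightarrow> 'b::euclidean_space"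
  assumes Z: "integrable M Z" and \<mu>: "(\<integral>s. Z s \<partial>M) = \<mu>"
    and V: "(\<integral>\<^sup>+s. ennreal ((norm (Z s - \<mu>))\<^sup>2) \<partial>M) \<le> ennreal V" and "V \<ge> 0"
  shows "(\<integral>\<^sup>+s. ennreal ((norm (a + c *\<^sub>R (Z s - \<mu>)))\<^sup>2) \<partial>M) \<le> ennreal ((norm a)\<^sup>2 + c\<^sup>2 * V)"
proof -
  have [measurable]: "Z \<in> borel_measurable M" using Z by simp
  have sq: "integrable M (\<lambda>s. (norm (Z s - \<mu>))\<^sup>2)"
    using V by (intro integrableI_bounded) (auto intro: le_less_trans)
  have exp: "(norm (a + c *\<^sub>R (Z s - \<mu>)))\<^sup>2
      = (norm a)\<^sup>2 + 2 * c * (a \<bullet> (Z s - \<mu>)) + c\<^sup>2 * (norm (Z s - \<mu>))\<^sup>2" for s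
    unfolding power2_norm_eq_inner inner_add_left inner_add_right inner_scaleR_left
      inner_scaleR_right by (simp add: inner_commute power2_eq_square algebra_simps)
  have lin: "integrable M (\<lambda>s. a \<bullet> (Z s - \<mu>))" using Z by simp
  \<comment> \<open>The cross term with the fixed vector \<open>a\<close> vanishes in the mean
    because the noise is centred, so only the two squares remain.\<close>
  have lin0: "(\<integral>s. a \<bullet> (Z s - \<mu>) \<partial>M) = 0"
    using Z by (simp add: \<mu> prob_space)
  have int: "integrable M (\<lambda>s. (norm (a + c *\<^sub>R (Z s - \<mu>)))\<^sup>2)"
    unfolding exp using lin sq by simp
  have "(\<integral>\<^sup>+s. ennreal ((norm (a + c *\<^sub>R (Z s - \<mu>)))\<^sup>2) \<partial>M)
      = ennreal (\<integral>s. (norm (a + c *\<^sub>R (Z s - \<mu>)))\<^sup>2 \<partial>M)"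
    by (rule nn_integral_eq_integral[OF int]) simp
  also have "(\<integral>s. (norm (a + c *\<^sub>R (Z s - \<mu>)))\<^sup>2 \<partial>M)
      = (norm a)\<^sup>2 + c\<^sup>2 * (\<integral>s. (norm (Z s - \<mu>))\<^sup>2 \<partial>M)"
    unfolding exp using lin sq by (simp add: lin0 prob_space)
  also have "(\<integral>s. (norm (Z s - \<mu>))\<^sup>2 \<partial>M) \<le> V"
  proof -
    have "ennreal (\<integral>s. (norm (Z s - \<mu>))\<^sup>2 \<partial>M) \<le> ennreal V"
      using V by (subst nn_integral_eq_integral[symmetric, OF sq]) auto
    then show ?thesis using \<open>V \<ge> 0\<close> by (simp add: ennreal_le_iff)
  qed
  finally show ?thesis by (simp add: ennreal_leI mult_left_mono)
qed

text \<open>Variance is second moment minus squared mean, and an infinite second moment leaves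
  nothing to show. Applied to a difference of stochastic gradients, this draws both a variance bound
  and a Lipschitz bound from (A2).\<close>

lemma (in prob_space) second_moment_bias_variance:
  fixes Z :: "'a \<Rightarrow> 'b::euclidean_space"
  assumes Z: "integrable M Z" and \<mu>: "(\<integral>s. Z s \<partial>M) = \<mu>"
  shows "(\<integral>\<^sup>+s. ennreal ((norm (Z s - \<mu>))\<^sup>2) \<partial>M) + ennreal ((norm \<mu>)\<^sup>2)
    \<le> (\<integral>\<^sup>+s. ennreal ((norm (Z s))\<^sup>2) \<partial>M)"
proof (cases "(\<integral>\<^sup>+s. ennreal ((norm (Z s))\<^sup>2) \<partial>M) = \<infinity>")
  case False
  have [measurable]: "Z \<in> borel_measurable M" using Z by simp
  have sq: "integrable M (\<lambda>s. (norm (Z s))\<^sup>2)"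
    using False by (intro integrableI_bounded) (auto simp: less_top)
  have exp: "(norm (Z s - \<mu>))\<^sup>2 = (norm (Z s))\<^sup>2 - 2 * (\<mu> \<bullet> Z s) + (norm \<mu>)\<^sup>2" for s
    unfolding power2_norm_eq_inner by (simp add: inner_diff_left inner_diff_right inner_commute)
  have lin: "integrable M (\<lambda>s. \<mu> \<bullet> Z s)" using Z by simp
  have lin0: "(\<integral>s. \<mu> \<bullet> Z s \<partial>M) = (norm \<mu>)\<^sup>2"
    using Z by (simp add: \<mu> power2_norm_eq_inner)
  have int: "integrable M (\<lambda>s. (norm (Z s - \<mu>))\<^sup>2)"
    unfolding exp using lin sq by simp
  have "(\<integral>s. (norm (Z s - \<mu>))\<^sup>2 \<partial>M) + (norm \<mu>)\<^sup>2 = (\<integral>s. (norm (Z s))\<^sup>2 \<partial>M)"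
    unfolding exp using lin sq by (simp add: lin0 prob_space)
  then show ?thesis
    using int sq by (simp add: nn_integral_eq_integral flip: ennreal_plus)
qed simp

text \<open>Redrawing coordinate \<open>i\<close> from P preserves the product law. The inner
  integral plays the role of the conditional expectation given all other samples.\<close>

lemma nn_integral_PiM_resample:
  fixes f :: "('i \<Rightarrow> 's) \<Rightarrow> ennreal"
  assumes P: "prob_space P" and "finite I" "i \<in> I"
    and f: "f \<in> borel_measurable (PiM I (\<lambda>_. P))"
  shows "(\<integral>\<^sup>+w. f w \<partial>PiM I (\<lambda>_. P)) = (\<integral>\<^sup>+w. (\<integral>\<^sup>+z. f (w(i := z)) \<partial>P) \<partial>PiM I (\<lambda>_. P))"
proof -
  interpret P: prob_space P by fact
  interpret product_sigma_finite "\<lambda>_::'i. P" by standard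
  define J where "J = I - {i}"
  have J: "finite J" "i \<notin> J" "insert i J = I"
    using assms(2,3) by (auto simp: J_def)
  note [measurable] = f
  have upd: "(\<lambda>(w, z). w(i := z)) \<in> PiM I (\<lambda>_. P) \<Otimes>\<^sub>M P \<rightarrow>\<^sub>M PiM I (\<lambda>_. P)"
    using measurable_add_dim[of i I "\<lambda>_. P"] assms(3) by (simp add: insert_absorb)
  have [measurable]: "(\<lambda>w. \<integral>\<^sup>+z. f (w(i := z)) \<partial>P) \<in> borel_measurable (PiM I (\<lambda>_. P))"
    using measurable_compose[OF upd f] by (intro P.borel_measurable_nn_integral) (simp add: split_beta')
  have "(\<integral>\<^sup>+w. (\<integral>\<^sup>+z. f (w(i := z)) \<partial>P) \<partial>PiM I (\<lambda>_. P))
      = (\<integral>\<^sup>+w. (\<integral>\<^sup>+y. (\<integral>\<^sup>+z. f (w(i := z)) \<partial>P) \<partial>P) \<partial>PiM J (\<lambda>_. P))"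
    using product_nn_integral_insert[OF J(1,2), of "\<lambda>w. \<integral>\<^sup>+z. f (w(i := z)) \<partial>P"] J(3) by simp
  also have "\<dots> = (\<integral>\<^sup>+w. (\<integral>\<^sup>+z. f (w(i := z)) \<partial>P) \<partial>PiM J (\<lambda>_. P))"
    by (simp add: P.emeasure_space_1)
  also have "\<dots> = (\<integral>\<^sup>+w. f w \<partial>PiM I (\<lambda>_. P))"
    using product_nn_integral_insert[OF J(1,2), of f] J(3) by simp
  finally show ?thesis by simp
qed

lemma integrable_nn_le:
  fixes h :: "'a \<Rightarrow> real"
  assumes h: "h \<in> borel_measurable M" "\<And>w. 0 \<le> h w" and le: "(\<integral>\<^sup>+w. ennreal (h w) \<partial>M) \<le> ennreal C" and "0 \<le> C"
  shows "integrable M h \<and> (\<integral>w. h w \<partial>M) \<le> C"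
proof
  show int: "integrable M h"
    using h le by (intro integrableI_bounded) (auto intro: le_less_trans)
  have "ennreal (\<integral>w. h w \<partial>M) \<le> ennreal C"
    using h le by (subst nn_integral_eq_integral[symmetric, OF int]) auto
  then show "(\<integral>w. h w \<partial>M) \<le> C" using \<open>0 \<le> C\<close> by (simp add: ennreal_le_iff)
qed

section \<open>The composite problem\<close>

locale stochastic_composite = P: prob_space P
  for P :: "'s measure" +
  fixes fs :: "'s \<Rightarrow> 'a::euclidean_space \<Rightarrow> real"
    and f F \<psi> :: "'a \<Rightarrow> ereal" and grad_f :: "'a \<Rightarrow> 'a" and L \<sigma> :: real
  assumes f_eq: "f = mean_fun P fs"
    and grad_f_eq: "grad_f = grad (\<lambda>x. real_of_ereal (f x))"
    and F_eq: "F = (\<lambda>x. f x + \<psi> x)"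
    and meas_fs: "\<And>x. (\<lambda>s. fs s x) \<in> borel_measurable P"
    and smooth_fs: "\<And>s x. s \<in> space P \<Longrightarrow> fs s differentiable (at x)"
      "\<And>s. s \<in> space P \<Longrightarrow> continuous_on UNIV (grad (fs s))"
    and diff_f: "open (edom f)"
      "\<And>x. x \<in> edom f \<Longrightarrow> (\<lambda>y. real_of_ereal (f y)) differentiable (at x)"
    and unbiased: "\<And>x. x \<in> edom f \<Longrightarrow> integrable P (\<lambda>s. grad (fs s) x)"
      "\<And>x. x \<in> edom f \<Longrightarrow> (\<integral>s. grad (fs s) x \<partial>P) = grad_f x"
    and \<psi>: "proper_fun \<psi>" "closed_fun \<psi>" "convex_fun \<psi>"
    and F_bounds: "edom F \<noteq> {}" "(INF x. F x) > -\<infinity>"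
    and L_pos: "L > 0"
    and Lipschitz: "\<And>x y. x \<in> edom F \<Longrightarrow> y \<in> edom F \<Longrightarrow>
         (\<integral>\<^sup>+s. ennreal ((norm (grad (fs s) x - grad (fs s) y))\<^sup>2) \<partial>P)
           \<le> ennreal (L\<^sup>2 * (norm (x - y))\<^sup>2)"
    and \<sigma>_nonneg: "\<sigma> \<ge> 0"
    and variance: "\<And>x. x \<in> edom F \<Longrightarrow>
         (\<integral>\<^sup>+s. ennreal ((norm (grad (fs s) x - grad_f x))\<^sup>2) \<partial>P) \<le> ennreal (\<sigma>\<^sup>2)"
begin

abbreviation "sgrad s x \<equiv> grad (fs s) x"

lemma sgrad_measurable [measurable]: "(\<lambda>s. sgrad s x) \<in> borel_measurable P"
  by (rule borel_measurable_grad[OF meas_fs smooth_fs(1)])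

lemma sgrad_joint_measurable:
  "(\<lambda>w. sgrad (fst w) (snd w)) \<in> borel_measurable (P \<Otimes>\<^sub>M borel)"
  by (rule borel_measurable_Caratheodory) (auto intro: smooth_fs)

lemma sgrad_compose_measurable [measurable (raw)]:
  assumes "X \<in> measurable N P" "Y \<in> borel_measurable N"
  shows "(\<lambda>w. sgrad (X w) (Y w)) \<in> borel_measurable N"
  using measurable_compose[OF measurable_Pair[OF assms] sgrad_joint_measurable] by simp

lemma edom_f_iff: "x \<in> edom f \<longleftrightarrow> integrable P (\<lambda>s. fs s x)"
  by (simp add: f_eq mean_fun_def edom_def)

lemma f_not_MInf: "f x \<noteq> -\<infinity>"
  by (simp add: f_eq mean_fun_def)

lemma edom_F: "edom F = edom f \<inter> edom \<psi>"
proof -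
  have "f x + \<psi> x < \<infinity> \<longleftrightarrow> f x < \<infinity> \<and> \<psi> x < \<infinity>" for x
    using f_not_MInf[of x] \<psi>(1) by (cases "f x"; cases "\<psi> x") (auto simp: proper_fun_def)
  then show ?thesis by (auto simp: edom_def F_eq)
qed

section \<open>The domain of \<psi> lies in the domain of f\<close>

lemma nn_integral_sgrad_le:
  assumes "x \<in> edom F" "y \<in> edom F"
  shows "(\<integral>\<^sup>+s. ennreal (norm (sgrad s y)) \<partial>P)
    \<le> (\<integral>\<^sup>+s. ennreal (norm (sgrad s x)) \<partial>P) + ennreal (1 + L\<^sup>2 * (norm (y - x))\<^sup>2)"
proof -
  have "norm (sgrad s y) \<le> norm (sgrad s x) + (1 + (norm (sgrad s y - sgrad s x))\<^sup>2)" for s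
  proof -
    \<comment> \<open>(A2) bounds a second moment, but a first moment is needed; n <= 1 + n^2
      converts one into the other, uniformly along a bounded segment.\<close>
    let ?n = "norm (sgrad s y - sgrad s x)"
    have "0 \<le> (?n - 1)\<^sup>2" by simp
    then have "2 * ?n \<le> 1 + ?n\<^sup>2" by (simp add: power2_eq_square algebra_simps)
    then have "?n \<le> 1 + ?n\<^sup>2" using norm_ge_zero[of "sgrad s y - sgrad s x"] by linarith
    then show ?thesis using norm_triangle_sub[of "sgrad s y" "sgrad s x"] by linarith
  qed
  then have "(\<integral>\<^sup>+s. ennreal (norm (sgrad s y)) \<partial>P)
      \<le> (\<integral>\<^sup>+s. ennreal (norm (sgrad s x)) + (ennreal 1 + ennreal ((norm (sgrad s y - sgrad s x))\<^sup>2)) \<partial>P)"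
    by (intro nn_integral_mono) (simp flip: ennreal_plus ennreal_1)
  also have "\<dots> = (\<integral>\<^sup>+s. ennreal (norm (sgrad s x)) \<partial>P)
      + (ennreal 1 + (\<integral>\<^sup>+s. ennreal ((norm (sgrad s y - sgrad s x))\<^sup>2) \<partial>P))"
    by (simp add: nn_integral_add P.emeasure_space_1)
  also have "\<dots> \<le> (\<integral>\<^sup>+s. ennreal (norm (sgrad s x)) \<partial>P)
      + (ennreal 1 + ennreal (L\<^sup>2 * (norm (y - x))\<^sup>2))"
    using Lipschitz[OF assms(2,1)] by (intro add_left_mono)
  also have "\<dots> = (\<integral>\<^sup>+s. ennreal (norm (sgrad s x)) \<partial>P) + ennreal (1 + L\<^sup>2 * (norm (y - x))\<^sup>2)"
    by (subst ennreal_plus[symmetric]) auto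
  finally show ?thesis .
qed

text \<open>Fundamental theorem of calculus along the segment for one fixed sample, then
  Cauchy-Schwarz. The extended nonnegative form can be integrated over the samples before any
  integrability is known.\<close>

lemma fs_increment_le:
  assumes "s \<in> space P"
  shows "ennreal \<bar>fs s (x + d) - fs s x\<bar>
    \<le> (\<integral>\<^sup>+t. ennreal (norm (sgrad s (x + t *\<^sub>R d)) * norm d) * indicator {0..1} t \<partial>lborel)"
proof -
  have "isCont (\<lambda>t. sgrad s (x + t *\<^sub>R d) \<bullet> d) t" for t
  proof -
    have "continuous_on UNIV (\<lambda>t. sgrad s (x + t *\<^sub>R d) \<bullet> d)"
      by (rule continuous_on_inner[OF continuous_on_compose2[OF smooth_fs(2)[OF assms]]])
        (auto intro!: continuous_intros)
    then show ?thesis by (simp add: continuous_on_eq_continuous_at)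
  qed
  then have hb: "has_bochner_integral lborel (\<lambda>t. (sgrad s (x + t *\<^sub>R d) \<bullet> d) * indicator {0..1} t)
      (fs s (x + 1 *\<^sub>R d) - fs s (x + 0 *\<^sub>R d))"
    by (intro has_bochner_integral_FTC_Icc_real DERIV_grad_line smooth_fs assms) auto
  then have "ennreal (norm (fs s (x + d) - fs s x))
      \<le> (\<integral>\<^sup>+t. norm ((sgrad s (x + t *\<^sub>R d) \<bullet> d) * indicator {0..1} t) \<partial>lborel)"
    using integral_norm_bound_ennreal[OF integrable.intros[OF hb]]
      has_bochner_integral_integral_eq[OF hb] by simp
  also have "\<dots> \<le> (\<integral>\<^sup>+t. ennreal (norm (sgrad s (x + t *\<^sub>R d)) * norm d) * indicator {0..1} t \<partial>lborel)"
    by (intro nn_integral_mono) (auto simp: indicator_def Cauchy_Schwarz_ineq2 intro!: ennreal_leI)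
  finally show ?thesis by simp
qed

text \<open>Lying in dom f means integrability over P. The increment of a sample function is bounded
  by gradient norms along the segment; by Tonelli its mean is bounded by their first moments, which
  (A2) keeps below one constant.\<close>

lemma edom_f_segment_endpoint:
  assumes seg: "\<And>t. 0 \<le> t \<Longrightarrow> t < 1 \<Longrightarrow> x + t *\<^sub>R d \<in> edom F"
  shows "x + d \<in> edom f"
proof -
  have x: "x \<in> edom F" using seg[of 0] by simp
  have [measurable]: "(\<lambda>s. fs s y) \<in> borel_measurable P" for y by (rule meas_fs)
  define C where "C = (\<integral>\<^sup>+s. ennreal (norm (sgrad s x)) \<partial>P) + ennreal (1 + L\<^sup>2 * (norm d)\<^sup>2)"
  have "integrable P (\<lambda>s. sgrad s x)"
    using x unbiased(1) by (simp add: edom_F)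
  then have C: "C < \<infinity>"
    unfolding C_def by (simp add: integrable_iff_bounded)
  have le: "(\<integral>\<^sup>+s. ennreal (norm (sgrad s (x + t *\<^sub>R d))) \<partial>P) \<le> C" if "0 \<le> t" "t < 1" for t
  proof -
    have "(norm (t *\<^sub>R d))\<^sup>2 \<le> (norm d)\<^sup>2"
      using that by (intro power_mono) (auto intro: mult_left_le_one_le)
    then have "ennreal (1 + L\<^sup>2 * (norm (t *\<^sub>R d))\<^sup>2) \<le> ennreal (1 + L\<^sup>2 * (norm d)\<^sup>2)"
      by (intro ennreal_leI add_left_mono mult_left_mono) auto
    then have "(\<integral>\<^sup>+s. ennreal (norm (sgrad s x)) \<partial>P) + ennreal (1 + L\<^sup>2 * (norm (x + t *\<^sub>R d - x))\<^sup>2) \<le> C"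
      unfolding C_def add_diff_cancel_left' by (rule add_left_mono)
    with nn_integral_sgrad_le[OF x seg[OF that]] show ?thesis by (rule order_trans)
  qed
  interpret pair_sigma_finite P "lborel :: real measure"
    by (intro pair_sigma_finite.intro P.sigma_finite_measure_axioms
        lborel.sigma_finite_measure_axioms)
  have "(\<integral>\<^sup>+s. ennreal \<bar>fs s (x + d) - fs s x\<bar> \<partial>P)
      \<le> (\<integral>\<^sup>+s. (\<integral>\<^sup>+t. ennreal (norm (sgrad s (x + t *\<^sub>R d)) * norm d) * indicator {0..1} t \<partial>lborel) \<partial>P)"
    by (intro nn_integral_mono fs_increment_le)
  also have "\<dots> = (\<integral>\<^sup>+t. (\<integral>\<^sup>+s. ennreal (norm (sgrad s (x + t *\<^sub>R d)) * norm d) * indicator {0..1} t \<partial>P) \<partial>lborel)"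
    by (rule Fubini'[symmetric]) measurable
  also have "\<dots> \<le> (\<integral>\<^sup>+t. (C * ennreal (norm d)) * indicator {0..1::real} t \<partial>lborel)"
  proof (rule nn_integral_mono_AE)
    \<comment> \<open>At t = 1 the point is not yet known to lie in dom F, so (A2) does not apply
      there; a single parameter is a null set.\<close>
    have "AE t in lborel. t \<noteq> (1::real)" by (rule AE_lborel_singleton)
    then show "AE t in lborel. (\<integral>\<^sup>+s. ennreal (norm (sgrad s (x + t *\<^sub>R d)) * norm d) * indicator {0..1} t \<partial>P)
        \<le> (C * ennreal (norm d)) * indicator {0..1} t"
    proof (rule AE_mp, intro AE_I2 impI)
      fix t :: real assume "t \<noteq> 1"
      show "(\<integral>\<^sup>+s. ennreal (norm (sgrad s (x + t *\<^sub>R d)) * norm d) * indicator {0..1} t \<partial>P)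
        \<le> (C * ennreal (norm d)) * indicator {0..1} t"
      proof (cases "t \<in> {0..1}")
        case True
        with \<open>t \<noteq> 1\<close> have "(\<integral>\<^sup>+s. ennreal (norm (sgrad s (x + t *\<^sub>R d))) \<partial>P) \<le> C"
          by (intro le) auto
        with True show ?thesis
          by (simp add: ennreal_mult nn_integral_multc mult_right_mono)
      qed auto
    qed
  qed
  also have "\<dots> = C * ennreal (norm d)"
    by (subst nn_integral_cmult_indicator) auto
  also have "\<dots> < \<infinity>" using C by (simp add: ennreal_mult_less_top)
  finally have "integrable P (\<lambda>s. fs s (x + d) - fs s x)"
    by (intro integrableI_bounded) auto
  moreover have "integrable P (\<lambda>s. fs s x)" using x by (simp add: edom_F edom_f_iff)
  ultimately have "integrable P (\<lambda>s. (fs s (x + d) - fs s x) + fs s x)"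
    by (rule Bochner_Integration.integrable_add)
  then show ?thesis by (simp add: edom_f_iff)
qed

text \<open>The iterates are only known to lie in the domain of \<open>\<psi>\<close>. It is contained in the domain of
  \<open>f\<close>: along a segment issuing from a point of the domain of \<open>F\<close>, the set of points in the domain of
  \<open>f\<close> is open, and it is closed because (A2) bounds the mean increment of \<open>f\<^sub>\<xi>\<close>.\<close>

lemma edom_\<psi>_subset_edom_f: "edom \<psi> \<subseteq> edom f"
proof
  fix y assume y: "y \<in> edom \<psi>"
  obtain x where x: "x \<in> edom F" using F_bounds(1) by auto
  define p where "p = (\<lambda>t. x + t *\<^sub>R (y - x))"
  have p\<psi>: "p t \<in> edom \<psi>" if "0 \<le> t" "t \<le> 1" for t
  proof -
    have "(1 - t) *\<^sub>R x + t *\<^sub>R y \<in> edom \<psi>"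
      using convexD[OF convex_edom[OF \<psi>(3)], of x y "1 - t" t] x y that by (auto simp: edom_F)
    then show ?thesis by (simp add: p_def algebra_simps)
  qed
  define T where "T = {0..1} \<inter> p -` (- edom f)"
  have "T = {}"
  proof (rule ccontr)
    assume "T \<noteq> {}"
    have "closed T" unfolding T_def
      using diff_f(1) by (intro continuous_closed_preimage) (auto simp: p_def intro!: continuous_intros)
    moreover have bdd: "bdd_below T" by (auto simp: T_def)
    ultimately have t: "Inf T \<in> T" using \<open>T \<noteq> {}\<close> by (intro closed_contains_Inf)
    \<comment> \<open>\<open>Inf T\<close> is the first parameter at which dom f is left. All
      earlier points lie in dom F, so the endpoint lemma puts the exit point itself into dom f, a
      contradiction. For \<open>Inf T = 0\<close> the segment is the single point
      \<open>x\<close>.\<close>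
    have "x + r *\<^sub>R (Inf T *\<^sub>R (y - x)) \<in> edom F" if r: "0 \<le> r" "r < 1" for r
    proof (cases "Inf T = 0")
      case False
      with t have "0 < Inf T" by (auto simp: T_def)
      with r have "r * Inf T < Inf T" by simp
      then have "r * Inf T \<notin> T" using cInf_lower[OF _ bdd, of "r * Inf T"] by auto
      moreover have "Inf T \<in> {0..1}" using t unfolding T_def by blast
      then have r01: "0 \<le> r * Inf T" "r * Inf T \<le> 1"
        using r \<open>0 < Inf T\<close> \<open>r * Inf T < Inf T\<close> unfolding atLeastAtMost_iff by (simp, linarith)
      ultimately have "p (r * Inf T) \<in> edom f" using r01 by (simp add: T_def)
      with p\<psi>[OF r01] have "p (r * Inf T) \<in> edom F" by (simp add: edom_F)
      then show ?thesis by (simp add: p_def)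
    qed (use x in simp)
    then have "p (Inf T) \<in> edom f"
      unfolding p_def by (rule edom_f_segment_endpoint)
    with t show False by (simp add: T_def)
  qed
  then have "1 \<notin> T" by simp
  then show "y \<in> edom f" by (simp add: T_def p_def)
qed

lemma edom_F_eq: "edom F = edom \<psi>"
  using edom_\<psi>_subset_edom_f by (auto simp: edom_F)

section \<open>Smoothness of the mean function on dom F\<close>

lemma sgrad_integrable: "x \<in> edom F \<Longrightarrow> integrable P (\<lambda>s. sgrad s x)"
  and sgrad_mean: "x \<in> edom F \<Longrightarrow> (\<integral>s. sgrad s x \<partial>P) = grad_f x"
  using unbiased by (auto simp: edom_F)

text \<open>(A2) controls both summands at once: the first bounds the noise that the sample
  \<open>Xi\<close> brings into the estimator, the second gives the Lipschitz constant of the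
  gradient of f.\<close>

lemma sgrad_diff_variance:
  assumes "x \<in> edom F" "y \<in> edom F"
  shows "(\<integral>\<^sup>+s. ennreal ((norm (sgrad s x - sgrad s y - (grad_f x - grad_f y)))\<^sup>2) \<partial>P)
      + ennreal ((norm (grad_f x - grad_f y))\<^sup>2) \<le> ennreal (L\<^sup>2 * (norm (x - y))\<^sup>2)"
  using assms
  by (intro order_trans[OF P.second_moment_bias_variance Lipschitz])
    (auto simp: sgrad_integrable sgrad_mean)

lemma grad_f_Lipschitz:
  assumes "x \<in> edom F" "y \<in> edom F"
  shows "norm (grad_f x - grad_f y) \<le> L * norm (x - y)"
proof -
  have "ennreal ((norm (grad_f x - grad_f y))\<^sup>2) \<le> ennreal (L\<^sup>2 * (norm (x - y))\<^sup>2)"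
    using order_trans[OF _ sgrad_diff_variance[OF assms]] by simp
  then have "(norm (grad_f x - grad_f y))\<^sup>2 \<le> (L * norm (x - y))\<^sup>2"
    by (simp add: power_mult_distrib)
  then show ?thesis by (rule power2_le_imp_le) (use L_pos in simp)
qed

text \<open>\<open>grad_f\<close> is identified with the mean stochastic gradient on dom F only. A
  map that stays there allows it to be replaced by a parametrized integral, which is
  measurable.\<close>

lemma grad_f_measurable:
  assumes X: "X \<in> borel_measurable N" and dom: "\<And>w. w \<in> space N \<Longrightarrow> X w \<in> edom F"
  shows "(\<lambda>w. grad_f (X w)) \<in> borel_measurable N"
proof -
  have "(\<lambda>x. \<integral>s. sgrad s x \<partial>P) \<in> borel_measurable borel"
    by (rule P.borel_measurable_lebesgue_integral) measurable
  from measurable_compose[OF X this]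
  have "(\<lambda>w. \<integral>s. sgrad s (X w) \<partial>P) \<in> borel_measurable N" .
  then show ?thesis
    by (rule measurable_cong[THEN iffD1, rotated]) (use dom in \<open>simp add: sgrad_mean\<close>)
qed

section \<open>Descent of the composite objective along a proximal step\<close>

abbreviation "rF x \<equiv> real_of_ereal (F x)"

lemma rF_eq:
  assumes "x \<in> edom F"
  shows "rF x = real_of_ereal (f x) + real_of_ereal (\<psi> x)"
proof -
  have "f x < \<infinity>" "\<psi> x < \<infinity>" "f x \<noteq> -\<infinity>" "\<psi> x \<noteq> -\<infinity>"
    using assms f_not_MInf \<psi>(1) unfolding edom_F by (auto simp: edom_def proper_fun_def)
  then show ?thesis by (cases "f x"; cases "\<psi> x") (auto simp: F_eq)
qed

lemma f_descent:
  assumes x: "x \<in> edom F" and y: "y \<in> edom F"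
  shows "real_of_ereal (f y) \<le> real_of_ereal (f x) + grad_f x \<bullet> (y - x) + L / 2 * (norm (y - x))\<^sup>2"
proof -
  define d where "d = y - x"
  \<comment> \<open>f along the segment minus the nonconstant part of the claimed bound. Convexity
    keeps the segment in dom F, where the Lipschitz gradient makes the derivative of
    \<open>h\<close> nonpositive; h 1 <= h 0 is the claim.\<close>
  define h where "h = (\<lambda>t. real_of_ereal (f (x + t *\<^sub>R d)) - t * (grad_f x \<bullet> d) - L / 2 * t\<^sup>2 * (norm d)\<^sup>2)"
  have seg: "x + t *\<^sub>R d \<in> edom F" if "0 \<le> t" "t \<le> 1" for t
  proof -
    have "(1 - t) *\<^sub>R x + t *\<^sub>R y \<in> edom \<psi>"
      using convexD[OF convex_edom[OF \<psi>(3)], of x y "1 - t" t] x y that by (auto simp: edom_F_eq)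
    then show ?thesis by (simp add: d_def algebra_simps edom_F_eq)
  qed
  have "h 1 \<le> h 0"
  proof (rule DERIV_nonpos_imp_nonincreasing[of 0 1 h])
    fix t :: real assume t: "0 \<le> t" "t \<le> 1"
    let ?D = "(grad_f (x + t *\<^sub>R d) - grad_f x) \<bullet> d - L * t * (norm d)\<^sup>2"
    have "((\<lambda>t. real_of_ereal (f (x + t *\<^sub>R d))) has_real_derivative grad_f (x + t *\<^sub>R d) \<bullet> d) (at t)"
      unfolding grad_f_eq by (rule DERIV_grad_line, rule diff_f) (use seg[OF t] in \<open>simp add: edom_F\<close>)
    then have "(h has_real_derivative ?D) (at t)"
      unfolding h_def by (auto intro!: derivative_eq_intros simp: inner_diff_left)
    moreover have "?D \<le> 0"
    proof -
      have "(grad_f (x + t *\<^sub>R d) - grad_f x) \<bullet> d \<le> norm (grad_f (x + t *\<^sub>R d) - grad_f x) * norm d"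
        by (rule norm_cauchy_schwarz)
      also have "\<dots> \<le> (L * norm (t *\<^sub>R d)) * norm d"
        using grad_f_Lipschitz[OF seg[OF t] x] by (intro mult_right_mono) auto
      finally show ?thesis using t by (simp add: power2_eq_square)
    qed
    ultimately show "\<exists>y. (h has_real_derivative y) (at t) \<and> y \<le> 0" by blast
  qed simp
  then show ?thesis by (simp add: h_def d_def)
qed

lemma rF_ge_INF:
  assumes "x \<in> edom F"
  shows "real_of_ereal (INF x. F x) \<le> rF x"
proof -
  have "(INF x. F x) \<le> F x" by (rule INF_lower) simp
  moreover have "F x < \<infinity>" using assms by (simp add: edom_def)
  ultimately show ?thesis using F_bounds(2) by (cases "INF x. F x"; cases "F x") auto
qed

text \<open>The smooth part costs L \<gamma>^2 / 2, convexity scales the change of \<psi> by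
  \<gamma>, and the variational inequality tested at \<open>x\<close> yields the gain 1 / \<eta>.
  The direction \<open>v\<close> is arbitrary, so this serves the estimator as well as the exact
  gradient.\<close>

lemma prox_step:
  fixes v :: 'a
  assumes x: "x \<in> edom F" and "\<eta> > 0" "0 \<le> \<gamma>" "\<gamma> \<le> 1"
  defines "u \<equiv> prox \<eta> \<psi> (x - \<eta> *\<^sub>R v)"
  shows "(1 - \<gamma>) *\<^sub>R x + \<gamma> *\<^sub>R u \<in> edom F"
    and "rF ((1 - \<gamma>) *\<^sub>R x + \<gamma> *\<^sub>R u)
      \<le> rF x + \<gamma> * ((grad_f x - v) \<bullet> (u - x)) + (L * \<gamma>\<^sup>2 / 2 - \<gamma> / \<eta>) * (norm (u - x))\<^sup>2"
proof -
  let ?y = "(1 - \<gamma>) *\<^sub>R x + \<gamma> *\<^sub>R u"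
  have u: "u \<in> edom \<psi>" unfolding u_def by (rule prox_in_edom[OF \<psi> \<open>\<eta> > 0\<close>])
  have x\<psi>: "x \<in> edom \<psi>" using x by (simp add: edom_F)
  show y: "?y \<in> edom F"
    using convexD[OF convex_edom[OF \<psi>(3)] x\<psi> u] assms(3,4) by (simp add: edom_F_eq)
  have yx: "?y - x = \<gamma> *\<^sub>R (u - x)" by (simp add: algebra_simps)
  have 1: "real_of_ereal (f ?y) \<le> real_of_ereal (f x) + \<gamma> * (grad_f x \<bullet> (u - x)) + L * \<gamma>\<^sup>2 / 2 * (norm (u - x))\<^sup>2"
    using f_descent[OF x y] unfolding yx by (simp add: power_mult_distrib)
  have "real_of_ereal (\<psi> ?y) \<le> (1 - \<gamma>) * real_of_ereal (\<psi> x) + \<gamma> * real_of_ereal (\<psi> u)"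
    using assms by (intro convex_fun_real_le \<psi> x\<psi> u)
  moreover have "real_of_ereal (\<psi> u) \<le> real_of_ereal (\<psi> x) - (norm (u - x))\<^sup>2 / \<eta> - v \<bullet> (u - x)"
  proof -
    have "\<eta> * real_of_ereal (\<psi> u) + (x - \<eta> *\<^sub>R v - u) \<bullet> (x - u) \<le> \<eta> * real_of_ereal (\<psi> x)"
      using prox_variational[OF \<psi> \<open>\<eta> > 0\<close> x\<psi>, of "x - \<eta> *\<^sub>R v"] by (simp add: u_def)
    moreover have "(x - \<eta> *\<^sub>R v - u) \<bullet> (x - u) = (norm (u - x))\<^sup>2 + \<eta> * (v \<bullet> (u - x))"
      unfolding power2_norm_eq_inner by (simp add: algebra_simps inner_commute)
    ultimately show ?thesis using \<open>\<eta> > 0\<close> by (simp add: field_simps)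
  qed
  then have "\<gamma> * real_of_ereal (\<psi> u) \<le> \<gamma> * (real_of_ereal (\<psi> x) - (norm (u - x))\<^sup>2 / \<eta> - v \<bullet> (u - x))"
    using assms(3) by (rule mult_left_mono)
  ultimately show "rF ?y
      \<le> rF x + \<gamma> * ((grad_f x - v) \<bullet> (u - x)) + (L * \<gamma>\<^sup>2 / 2 - \<gamma> / \<eta>) * (norm (u - x))\<^sup>2"
    using 1 unfolding rF_eq[OF x] rF_eq[OF y] by (simp add: algebra_simps)
qed

end

section \<open>Iterates and estimator errors\<close>

lemma finite_hsgd_samples: "finite (hsgd_samples b m)"
  by (simp add: hsgd_samples_def)

text \<open>The state after t iterations reads only the samples drawn so far; later ones can be
  redrawn without disturbing it.\<close>

lemma proxHSGD_cong:
  assumes "\<And>i. i \<in> hsgd_samples b t \<Longrightarrow> w i = w' i"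
  shows "proxHSGD g \<psi> b \<beta> \<gamma> \<eta> x0 w t = proxHSGD g \<psi> b \<beta> \<gamma> \<eta> x0 w' t"
  using assms
proof (induction t)
  case 0
  then have "(\<Sum>i<b. g (w (Batch i)) x0) = (\<Sum>i<b. g (w' (Batch i)) x0)"
    by (intro sum.cong) (auto simp: hsgd_samples_def)
  then show ?case by simp
next
  case (Suc t)
  have "proxHSGD g \<psi> b \<beta> \<gamma> \<eta> x0 w t = proxHSGD g \<psi> b \<beta> \<gamma> \<eta> x0 w' t"
    by (rule Suc.IH, rule Suc.prems) (auto simp: hsgd_samples_def)
  moreover have "w (Xi (Suc t)) = w' (Xi (Suc t))" "w (Zeta (Suc t)) = w' (Zeta (Suc t))"
    by (auto intro!: Suc.prems simp: hsgd_samples_def)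
  ultimately show ?case by simp
qed

lemma prox_calls_proxHSGD: "prox_calls (proxHSGD g \<psi> b \<beta> \<gamma> \<eta> x0 w t) = t + 1"
  by (induction t) (simp_all add: Let_def)

lemma grad_calls_proxHSGD: "grad_calls (proxHSGD g \<psi> b \<beta> \<gamma> \<eta> x0 w t) = b + 3 * t"
  by (induction t) (simp_all add: Let_def)

lemma norm_add_power2_le:
  fixes x y :: "'a::real_inner"
  shows "(norm (x + y))\<^sup>2 \<le> 2 * (norm x)\<^sup>2 + 2 * (norm y)\<^sup>2"
  using zero_le_power2[of "norm (x - y)"] unfolding power2_norm_eq_inner
  by (simp add: inner_add_left inner_add_right inner_diff_left inner_diff_right inner_commute)

locale hsgd = stochastic_composite P fs f F \<psi> grad_f L \<sigma>
  for P :: "'s measure" and fs :: "'s \<Rightarrow> 'a::euclidean_space \<Rightarrow> real"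
    and f F \<psi> :: "'a \<Rightarrow> ereal" and grad_f :: "'a \<Rightarrow> 'a" and L \<sigma> :: real +
  fixes \<beta> \<gamma> \<eta> :: real and b m :: nat and x0 :: 'a
  assumes \<beta>: "0 \<le> \<beta>" "\<beta> < 1" and \<gamma>: "0 < \<gamma>" "\<gamma> \<le> 1"
    and \<eta>_eq: "\<eta> = 2 / ((3 + \<gamma>) * L)"
    and b_pos: "b > 0" and x0: "x0 \<in> edom F"
begin

abbreviation "state w t \<equiv> proxHSGD (\<lambda>s. grad (fs s)) \<psi> b (\<lambda>_. \<beta>) (\<lambda>_. \<gamma>) (\<lambda>_. \<eta>) x0 w t"

definition "xs t w = iterate (state w t)"
definition "vs t w = estimator (state w t)"
text \<open>Indexed by the iteration that computes it: this is the hatted point with subscript t + 1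
  of the algorithm.\<close>

definition "us t w = prox \<eta> \<psi> (xs t w - \<eta> *\<^sub>R vs t w)"
definition "err t w = vs t w - grad_f (xs t w)"
abbreviation "gmap x \<equiv> grad_mapping \<eta> \<psi> grad_f x"
abbreviation "samples \<equiv> hsgd_samples b m"
abbreviation "Q \<equiv> PiM samples (\<lambda>_. P)"

lemma \<eta>_pos: "\<eta> > 0"
  using \<gamma> L_pos by (simp add: \<eta>_eq)

lemma \<eta>_bounds: "1 / (2 * L) \<le> \<eta>" "\<eta> \<le> 2 / (3 * L)"
proof -
  have "2 / (4 * L) \<le> 2 / ((3 + \<gamma>) * L)" "2 / ((3 + \<gamma>) * L) \<le> 2 / (3 * L)"
    using \<gamma> L_pos by (intro divide_left_mono mult_right_mono mult_pos_pos; simp)+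
  then show "1 / (2 * L) \<le> \<eta>" "\<eta> \<le> 2 / (3 * L)" by (simp_all add: \<eta>_eq)
qed

lemma next_iterate_eq: "next_iterate (state w t) = (1 - \<gamma>) *\<^sub>R xs t w + \<gamma> *\<^sub>R us t w"
  by (cases t) (simp_all add: xs_def us_def vs_def Let_def)

lemma xs_0: "xs 0 w = x0"
  by (simp add: xs_def Let_def)

lemma xs_Suc: "xs (Suc t) w = (1 - \<gamma>) *\<^sub>R xs t w + \<gamma> *\<^sub>R us t w"
  by (simp add: xs_def[of "Suc t"] Let_def next_iterate_eq)

lemma vs_0: "vs 0 w = (1 / real b) *\<^sub>R (\<Sum>i<b. sgrad (w (Batch i)) x0)"
  by (simp add: vs_def Let_def)

lemma vs_Suc: "vs (Suc t) w = \<beta> *\<^sub>R vs t w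
    + \<beta> *\<^sub>R (sgrad (w (Xi (Suc t))) (xs (Suc t) w) - sgrad (w (Xi (Suc t))) (xs t w))
    + (1 - \<beta>) *\<^sub>R sgrad (w (Zeta (Suc t))) (xs (Suc t) w)"
  by (simp add: vs_def Let_def xs_Suc next_iterate_eq) (simp add: xs_def)

lemma xs_in_edom: "xs t w \<in> edom F"
proof (induction t)
  case (Suc t)
  then show ?case unfolding xs_Suc us_def using prox_step(1) \<eta>_pos \<gamma> by simp
qed (simp add: xs_0 x0)

lemma state_fun_upd: "i \<notin> hsgd_samples b t \<Longrightarrow> state (w(i := z)) t = state w t"
  by (rule proxHSGD_cong) auto

text \<open>Iterate t + 1 is already fixed at the end of iteration t, before
  \<open>Xi (Suc t)\<close> and \<open>Zeta (Suc t)\<close> are drawn, so these samples are fresh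
  for it too.\<close>

lemma
  assumes "i \<notin> hsgd_samples b t"
  shows xs_fun_upd: "xs t (w(i := z)) = xs t w" and xs_Suc_fun_upd: "xs (Suc t) (w(i := z)) = xs (Suc t) w"
    and err_fun_upd: "err t (w(i := z)) = err t w"
  unfolding err_def xs_Suc us_def unfolding xs_def vs_def state_fun_upd[OF assms] by (rule refl)+

section \<open>Law of the samples and measurability of the iterates\<close>

lemma prob_space_Q: "prob_space Q"
  by (rule prob_space_PiM) (rule P.prob_space_axioms)

lemma sample_measurable: "i \<in> samples \<Longrightarrow> (\<lambda>w. w i) \<in> measurable Q P"
  by (rule measurable_component_singleton)

lemma prox_measurable [measurable]: "prox \<eta> \<psi> \<in> borel_measurable borel"
  by (rule borel_measurable_prox[OF \<psi> \<eta>_pos])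

lemma xs_vs_measurable:
  assumes "t \<le> m"
  shows "xs t \<in> borel_measurable Q \<and> vs t \<in> borel_measurable Q"
  using assms
proof (induction t)
  case 0
  have "(\<lambda>w. sgrad (w (Batch i)) x0) \<in> borel_measurable Q" if "i < b" for i
    using that by (intro sgrad_compose_measurable sample_measurable) (auto simp: hsgd_samples_def)
  then have "vs 0 \<in> borel_measurable Q"
    unfolding vs_0[abs_def] by (intro borel_measurable_scaleR borel_measurable_sum) auto
  then show ?case by (simp add: xs_0[abs_def])
next
  case (Suc t)
  then have [measurable]: "xs t \<in> borel_measurable Q" "vs t \<in> borel_measurable Q" by auto
  have [measurable]: "(\<lambda>w. w (Xi (Suc t))) \<in> measurable Q P" "(\<lambda>w. w (Zeta (Suc t))) \<in> measurable Q P"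
    using Suc.prems by (auto intro!: sample_measurable simp: hsgd_samples_def)
  have [measurable]: "xs (Suc t) \<in> borel_measurable Q"
    unfolding xs_Suc[abs_def] us_def by measurable
  show ?case unfolding vs_Suc[abs_def] by measurable
qed

lemma
  assumes "t \<le> m"
  shows xs_measurable: "xs t \<in> borel_measurable Q"
    and us_measurable: "us t \<in> borel_measurable Q"
    and xs_Suc_measurable: "xs (Suc t) \<in> borel_measurable Q"
    and err_measurable: "err t \<in> borel_measurable Q"
    and gmap_measurable: "(\<lambda>w. gmap (xs t w)) \<in> borel_measurable Q"
proof -
  have [measurable]: "xs t \<in> borel_measurable Q" "vs t \<in> borel_measurable Q"
    using xs_vs_measurable[OF assms] by auto
  have [measurable]: "(\<lambda>w. grad_f (xs t w)) \<in> borel_measurable Q"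
    by (rule grad_f_measurable) (auto simp: xs_in_edom)
  show "xs t \<in> borel_measurable Q" by fact
  show u [measurable]: "us t \<in> borel_measurable Q" unfolding us_def by measurable
  show "xs (Suc t) \<in> borel_measurable Q" unfolding xs_Suc[abs_def] by measurable
  show "err t \<in> borel_measurable Q" unfolding err_def by measurable
  show "(\<lambda>w. gmap (xs t w)) \<in> borel_measurable Q" unfolding grad_mapping_def by measurable
qed

section \<open>Second moments of the estimator error\<close>

lemma nn_integral_err_0: "(\<integral>\<^sup>+w. ennreal ((norm (err 0 w))\<^sup>2) \<partial>Q) \<le> ennreal (\<sigma>\<^sup>2 / real b)"
proof -
  interpret Q: prob_space Q by (rule prob_space_Q)
  \<comment> \<open>Partial sums of the centred batch gradients. Redrawing the newest batch member
    shows that each one adds at most \<sigma>^2, so the average of b members has second moment at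
    most \<sigma>^2 / b.\<close>
  define B where "B = (\<lambda>k w. \<Sum>i<k. sgrad (w (Batch i)) x0 - grad_f x0)"
  have meas [measurable]: "B k \<in> borel_measurable Q" if "k \<le> b" for k
    unfolding B_def using that
    by (intro borel_measurable_sum borel_measurable_diff sgrad_compose_measurable sample_measurable)
      (auto simp: hsgd_samples_def)
  have "(\<integral>\<^sup>+w. ennreal ((norm (B k w))\<^sup>2) \<partial>Q) \<le> ennreal (real k * \<sigma>\<^sup>2)" if "k \<le> b" for k
    using that
  proof (induction k)
    case 0
    then show ?case by (simp add: B_def)
  next
    case (Suc k)
    have mem: "Batch k \<in> samples" using Suc.prems by (auto simp: hsgd_samples_def)
    have upd: "B (Suc k) (w(Batch k := z)) = B k w + 1 *\<^sub>R (sgrad z x0 - grad_f x0)" for w z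
      unfolding B_def by (simp add: add.commute)
    have "(\<integral>\<^sup>+w. ennreal ((norm (B (Suc k) w))\<^sup>2) \<partial>Q)
        = (\<integral>\<^sup>+w. (\<integral>\<^sup>+z. ennreal ((norm (B (Suc k) (w(Batch k := z))))\<^sup>2) \<partial>P) \<partial>Q)"
      using meas[OF Suc.prems]
      by (intro nn_integral_PiM_resample P.prob_space_axioms finite_hsgd_samples mem) simp
    also have "\<dots> \<le> (\<integral>\<^sup>+w. ennreal ((norm (B k w))\<^sup>2 + 1\<^sup>2 * \<sigma>\<^sup>2) \<partial>Q)"
      unfolding upd
      by (intro nn_integral_mono P.nn_integral_noise_le sgrad_integrable sgrad_mean variance x0) auto
    also have "\<dots> = (\<integral>\<^sup>+w. ennreal ((norm (B k w))\<^sup>2) \<partial>Q) + ennreal (\<sigma>\<^sup>2)"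
      using meas[of k] Suc.prems by (simp add: nn_integral_add Q.emeasure_space_1)
    also have "\<dots> \<le> ennreal (real k * \<sigma>\<^sup>2) + ennreal (\<sigma>\<^sup>2)"
      using Suc by (intro add_right_mono) simp
    also have "\<dots> = ennreal (real (Suc k) * \<sigma>\<^sup>2)"
      by (subst ennreal_plus[symmetric]) (auto simp: algebra_simps)
    finally show ?case .
  qed
  note le = this[OF order.refl]
  have "err 0 w = (1 / real b) *\<^sub>R B b w" for w
    using b_pos by (simp add: err_def vs_0 xs_0 B_def sum_subtractf scaleR_diff_right sum_constant_scaleR)
  then have "(\<integral>\<^sup>+w. ennreal ((norm (err 0 w))\<^sup>2) \<partial>Q)
      = (\<integral>\<^sup>+w. ennreal ((1 / real b)\<^sup>2) * ennreal ((norm (B b w))\<^sup>2) \<partial>Q)"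
    by (simp add: power_mult_distrib power_divide flip: ennreal_mult)
  also have "\<dots> = ennreal ((1 / real b)\<^sup>2) * (\<integral>\<^sup>+w. ennreal ((norm (B b w))\<^sup>2) \<partial>Q)"
    using meas[of b] by (intro nn_integral_cmult) simp
  also have "\<dots> \<le> ennreal ((1 / real b)\<^sup>2) * ennreal (real b * \<sigma>\<^sup>2)"
    using le by (rule mult_left_mono) simp
  also have "\<dots> = ennreal (\<sigma>\<^sup>2 / real b)"
    using b_pos by (simp add: power2_eq_square flip: ennreal_mult)
  finally show ?thesis .
qed

text \<open>The two samples are integrated out in turn, \<open>Zeta\<close> and then
  \<open>Xi\<close>. With everything else fixed, each enters through a centred term, so the squares
  add without cross terms.\<close>

lemma nn_integral_err_Suc:
  assumes "t < m"
  shows "(\<integral>\<^sup>+w. ennreal ((norm (err (Suc t) w))\<^sup>2) \<partial>Q)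
    \<le> (\<integral>\<^sup>+w. ennreal (\<beta>\<^sup>2 * (norm (err t w))\<^sup>2 + \<beta>\<^sup>2 * L\<^sup>2 * (norm (xs (Suc t) w - xs t w))\<^sup>2
        + (1 - \<beta>)\<^sup>2 * \<sigma>\<^sup>2) \<partial>Q)"
proof -
  interpret Q: prob_space Q by (rule prob_space_Q)
  let ?i = "Zeta (Suc t)" and ?j = "Xi (Suc t)"
  have ij: "?i \<in> samples" "?j \<in> samples" "?i \<notin> hsgd_samples b t" "?j \<notin> hsgd_samples b t"
    using assms by (auto simp: hsgd_samples_def)
  \<comment> \<open>The part of the new error that is free of \<open>Zeta (Suc t)\<close>. Since the
    weights \<beta> and 1 - \<beta> sum to one, the gradient at the new iterate can be shared
    between the two parts so that both sample contributions are centred.\<close>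
  define A where "A = (\<lambda>w. \<beta> *\<^sub>R err t w + \<beta> *\<^sub>R (sgrad (w ?j) (xs (Suc t) w) - sgrad (w ?j) (xs t w)
    - (grad_f (xs (Suc t) w) - grad_f (xs t w))))"
  have [measurable]: "xs t \<in> borel_measurable Q" "err t \<in> borel_measurable Q"
      "xs (Suc t) \<in> borel_measurable Q" "err (Suc t) \<in> borel_measurable Q"
    using assms by (auto intro: xs_measurable err_measurable)
  have [measurable]: "(\<lambda>w. grad_f (xs t w)) \<in> borel_measurable Q"
      "(\<lambda>w. grad_f (xs (Suc t) w)) \<in> borel_measurable Q"
    by (rule grad_f_measurable, measurable, simp add: xs_in_edom)+
  have [measurable]: "(\<lambda>w. w ?j) \<in> measurable Q P" by (rule sample_measurable[OF ij(2)])
  have [measurable]: "A \<in> borel_measurable Q" unfolding A_def by measurable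
  have err_upd: "err (Suc t) (w(?i := z)) = A w + (1 - \<beta>) *\<^sub>R (sgrad z (xs (Suc t) w) - grad_f (xs (Suc t) w))"
    for w z
  proof -
    have "vs t (w(?i := z)) = vs t w"
      unfolding vs_def state_fun_upd[OF ij(3)] ..
    then show ?thesis
      unfolding A_def err_def vs_Suc xs_fun_upd[OF ij(3)] xs_Suc_fun_upd[OF ij(3)]
      by (simp add: algebra_simps)
  qed
  have A_upd: "A (w(?j := z)) = \<beta> *\<^sub>R err t w
      + \<beta> *\<^sub>R (sgrad z (xs (Suc t) w) - sgrad z (xs t w) - (grad_f (xs (Suc t) w) - grad_f (xs t w)))" for w z
    unfolding A_def xs_fun_upd[OF ij(4)] xs_Suc_fun_upd[OF ij(4)] err_fun_upd[OF ij(4)] by simp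
  have "(\<integral>\<^sup>+w. ennreal ((norm (err (Suc t) w))\<^sup>2) \<partial>Q)
      = (\<integral>\<^sup>+w. (\<integral>\<^sup>+z. ennreal ((norm (err (Suc t) (w(?i := z))))\<^sup>2) \<partial>P) \<partial>Q)"
    by (intro nn_integral_PiM_resample P.prob_space_axioms finite_hsgd_samples ij) simp
  also have "\<dots> \<le> (\<integral>\<^sup>+w. ennreal ((norm (A w))\<^sup>2 + (1 - \<beta>)\<^sup>2 * \<sigma>\<^sup>2) \<partial>Q)"
    unfolding err_upd
    by (intro nn_integral_mono P.nn_integral_noise_le sgrad_integrable sgrad_mean variance xs_in_edom) auto
  \<comment> \<open>Second redraw, now of \<open>Xi (Suc t)\<close>, which \<open>A\<close> contains
    only through the centred gradient difference.\<close>
  also have "\<dots> = (\<integral>\<^sup>+w. (\<integral>\<^sup>+z. ennreal ((norm (A (w(?j := z))))\<^sup>2 + (1 - \<beta>)\<^sup>2 * \<sigma>\<^sup>2) \<partial>P) \<partial>Q)"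
    by (intro nn_integral_PiM_resample P.prob_space_axioms finite_hsgd_samples ij) simp
  also have "\<dots> \<le> (\<integral>\<^sup>+w. ennreal (\<beta>\<^sup>2 * (norm (err t w))\<^sup>2 + \<beta>\<^sup>2 * L\<^sup>2 * (norm (xs (Suc t) w - xs t w))\<^sup>2
        + (1 - \<beta>)\<^sup>2 * \<sigma>\<^sup>2) \<partial>Q)"
  proof (rule nn_integral_mono)
    fix w
    let ?x = "xs (Suc t) w" and ?y = "xs t w"
    have xy: "?x \<in> edom F" "?y \<in> edom F" by (rule xs_in_edom)+
    have "(\<integral>\<^sup>+z. ennreal ((norm (A (w(?j := z))))\<^sup>2) \<partial>P)
        \<le> ennreal ((norm (\<beta> *\<^sub>R err t w))\<^sup>2 + \<beta>\<^sup>2 * (L\<^sup>2 * (norm (?x - ?y))\<^sup>2))"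
      unfolding A_upd
    proof (rule P.nn_integral_noise_le)
      show "(\<integral>\<^sup>+z. ennreal ((norm (sgrad z ?x - sgrad z ?y - (grad_f ?x - grad_f ?y)))\<^sup>2) \<partial>P)
          \<le> ennreal (L\<^sup>2 * (norm (?x - ?y))\<^sup>2)"
        by (rule order_trans[OF _ sgrad_diff_variance[OF xy]]) simp
    qed (use xy in \<open>auto simp: sgrad_integrable sgrad_mean\<close>)
    moreover have "(\<integral>\<^sup>+z. ennreal ((norm (A (w(?j := z))))\<^sup>2 + (1 - \<beta>)\<^sup>2 * \<sigma>\<^sup>2) \<partial>P)
        = (\<integral>\<^sup>+z. ennreal ((norm (A (w(?j := z))))\<^sup>2) \<partial>P) + ennreal ((1 - \<beta>)\<^sup>2 * \<sigma>\<^sup>2)"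
      unfolding A_upd by (simp add: nn_integral_add P.emeasure_space_1)
    ultimately have "(\<integral>\<^sup>+z. ennreal ((norm (A (w(?j := z))))\<^sup>2 + (1 - \<beta>)\<^sup>2 * \<sigma>\<^sup>2) \<partial>P)
        \<le> ennreal ((norm (\<beta> *\<^sub>R err t w))\<^sup>2 + \<beta>\<^sup>2 * (L\<^sup>2 * (norm (?x - ?y))\<^sup>2)) + ennreal ((1 - \<beta>)\<^sup>2 * \<sigma>\<^sup>2)"
      by (simp only: add_right_mono)
    also have "\<dots> = ennreal (\<beta>\<^sup>2 * (norm (err t w))\<^sup>2 + \<beta>\<^sup>2 * L\<^sup>2 * (norm (?x - ?y))\<^sup>2 + (1 - \<beta>)\<^sup>2 * \<sigma>\<^sup>2)"
      by (subst ennreal_plus[symmetric]) (auto simp: power_mult_distrib mult.assoc)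
    finally show "(\<integral>\<^sup>+z. ennreal ((norm (A (w(?j := z))))\<^sup>2 + (1 - \<beta>)\<^sup>2 * \<sigma>\<^sup>2) \<partial>P)
        \<le> ennreal (\<beta>\<^sup>2 * (norm (err t w))\<^sup>2 + \<beta>\<^sup>2 * L\<^sup>2 * (norm (?x - ?y))\<^sup>2 + (1 - \<beta>)\<^sup>2 * \<sigma>\<^sup>2)" .
  qed
  finally show ?thesis .
qed

section \<open>Expected descent\<close>

abbreviation "gap \<equiv> rF x0 - real_of_ereal (INF x. F x)"

definition "step t w = us t w - xs t w"

text \<open>Price of the squared error in one step, per unit of \<gamma>: 1 / (2 L) from Young's
  inequality, and 2 * 7/20 * L \<eta>^2 from passing from the estimator to the exact gradient
  mapping.\<close>

definition "noise_weight = 1 / (2 * L) + 7 / 10 * L * \<eta>\<^sup>2"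

lemma noise_weight_nonneg: "noise_weight \<ge> 0"
  using L_pos by (simp add: noise_weight_def)

text \<open>Replacing the estimator by the exact gradient moves the proximal point by at most \<eta>
  |err|, by nonexpansiveness; the factors 2 come from splitting at \<open>us t w\<close>.\<close>

lemma gmap_le: "\<eta>\<^sup>2 * (norm (gmap (xs t w)))\<^sup>2 \<le> 2 * (norm (step t w))\<^sup>2 + 2 * \<eta>\<^sup>2 * (norm (err t w))\<^sup>2"
proof -
  let ?x = "xs t w"
  let ?p = "prox \<eta> \<psi> (?x - \<eta> *\<^sub>R grad_f ?x)"
  have "norm (us t w - ?p) \<le> norm ((?x - \<eta> *\<^sub>R vs t w) - (?x - \<eta> *\<^sub>R grad_f ?x))"
    unfolding us_def by (rule prox_nonexpansive[OF \<psi> \<eta>_pos])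
  also have "(?x - \<eta> *\<^sub>R vs t w) - (?x - \<eta> *\<^sub>R grad_f ?x) = - (\<eta> *\<^sub>R err t w)"
    by (simp add: err_def algebra_simps)
  finally have "(norm (us t w - ?p))\<^sup>2 \<le> (\<eta> * norm (err t w))\<^sup>2"
    using \<eta>_pos by (intro power_mono) auto
  moreover have "\<eta>\<^sup>2 * (norm (gmap ?x))\<^sup>2 = (norm (?x - ?p))\<^sup>2"
    using \<eta>_pos by (simp add: grad_mapping_def power_mult_distrib[symmetric])
  moreover have "(norm (?x - ?p))\<^sup>2 \<le> 2 * (norm (?x - us t w))\<^sup>2 + 2 * (norm (us t w - ?p))\<^sup>2"
    using norm_add_power2_le[of "?x - us t w" "us t w - ?p"] by simp
  ultimately show ?thesis
    by (simp add: step_def norm_minus_commute power_mult_distrib)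
qed

text \<open>Young's inequality \<open>\<langle>e, d\<rangle> \<le> |e|\<^sup>2 / (2 L) + L |d|\<^sup>2 / 2\<close> and \<open>7 L \<gamma> / 20\<close> times \<open>gmap_le\<close>. The
  usual weight \<open>L \<gamma> / 4\<close> would already give the rate of part (b), but part (c) loses a factor
  up to \<open>((m + 2) / (m + 1)) powr (2/3)\<close> by rounding and needs a bound that is smaller by \<open>5 / 7\<close>.\<close>

lemma one_step_descent:
  "rF (xs (Suc t) w) + 7 / 20 * L * \<gamma> * \<eta>\<^sup>2 * (norm (gmap (xs t w)))\<^sup>2 + 3 / 10 * \<gamma> * L * (norm (step t w))\<^sup>2
    \<le> rF (xs t w) + \<gamma> * noise_weight * (norm (err t w))\<^sup>2"
proof -
  let ?D = "(norm (step t w))\<^sup>2" and ?E = "(norm (err t w))\<^sup>2"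
  have step: "rF (xs (Suc t) w) \<le> rF (xs t w) + \<gamma> * ((grad_f (xs t w) - vs t w) \<bullet> step t w)
      + (L * \<gamma>\<^sup>2 / 2 - \<gamma> / \<eta>) * ?D"
    unfolding xs_Suc us_def step_def using \<eta>_pos \<gamma> by (intro prox_step(2) xs_in_edom) auto
  have young: "(grad_f (xs t w) - vs t w) \<bullet> step t w \<le> ?E / (2 * L) + L * ?D / 2"
  proof -
    have "0 \<le> (norm (err t w + L *\<^sub>R step t w))\<^sup>2" by simp
    also have "\<dots> = ?E + 2 * L * (err t w \<bullet> step t w) + L\<^sup>2 * ?D"
      unfolding power2_norm_eq_inner inner_add_left inner_add_right inner_scaleR_left inner_scaleR_right
      by (simp add: inner_commute power2_eq_square algebra_simps)
    finally have "2 * L * (- (err t w \<bullet> step t w)) \<le> ?E + L\<^sup>2 * ?D" by simp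
    also have "\<dots> = 2 * L * (?E / (2 * L) + L * ?D / 2)"
      using L_pos by (simp add: field_simps power2_eq_square)
    finally have "2 * L * (- (err t w \<bullet> step t w)) \<le> 2 * L * (?E / (2 * L) + L * ?D / 2)" .
    then have "- (err t w \<bullet> step t w) \<le> ?E / (2 * L) + L * ?D / 2"
      using L_pos by (simp only: mult_le_cancel_left_pos)
    then show ?thesis by (simp add: err_def inner_diff_left)
  qed
  have "\<gamma> * ((grad_f (xs t w) - vs t w) \<bullet> step t w) \<le> \<gamma> * (?E / (2 * L) + L * ?D / 2)"
    using young \<gamma> by (intro mult_left_mono) auto
  \<comment> \<open>The choice of \<eta> makes \<gamma> / \<eta> contain L \<gamma>^2 / 2, which
    cancels the curvature term exactly. What remains is -(3/2) \<gamma> L, of which Young's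
    inequality takes back \<gamma> L / 2.\<close>
  moreover have "\<gamma> / \<eta> = \<gamma> * (3 + \<gamma>) * L / 2" by (simp add: \<eta>_eq)
  then have "(L * \<gamma>\<^sup>2 / 2 - \<gamma> / \<eta>) * ?D = - (3 / 2) * (\<gamma> * L * ?D)"
    by (simp add: algebra_simps power2_eq_square add_divide_distrib diff_divide_distrib)
  ultimately have 1: "rF (xs (Suc t) w) \<le> rF (xs t w) + \<gamma> * (?E / (2 * L)) - \<gamma> * L * ?D"
    using step by (simp add: algebra_simps)
  \<comment> \<open>Of the remaining gain \<gamma> L, 7/10 pays for the step term of
    \<open>gmap_le\<close>; 3/10 is kept to absorb the error recursion.\<close>
  have "7 / 20 * L * \<gamma> * (\<eta>\<^sup>2 * (norm (gmap (xs t w)))\<^sup>2) \<le> 7 / 20 * L * \<gamma> * (2 * ?D + 2 * \<eta>\<^sup>2 * ?E)"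
    using gmap_le \<gamma> L_pos by (intro mult_left_mono) auto
  with 1 show ?thesis by (simp add: noise_weight_def algebra_simps)
qed

lemma sum_descent:
  "(\<Sum>t\<le>k. 7 / 20 * L * \<gamma> * \<eta>\<^sup>2 * (norm (gmap (xs t w)))\<^sup>2 + 3 / 10 * \<gamma> * L * (norm (step t w))\<^sup>2)
    \<le> gap + \<gamma> * noise_weight * (\<Sum>t\<le>k. (norm (err t w))\<^sup>2)"
proof -
  have "(\<Sum>t\<le>k. 7 / 20 * L * \<gamma> * \<eta>\<^sup>2 * (norm (gmap (xs t w)))\<^sup>2 + 3 / 10 * \<gamma> * L * (norm (step t w))\<^sup>2)
      \<le> (\<Sum>t\<le>k. (rF (xs t w) - rF (xs (Suc t) w)) + \<gamma> * noise_weight * (norm (err t w))\<^sup>2)"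
    by (intro sum_mono) (use one_step_descent in \<open>simp add: algebra_simps\<close>)
  also have "\<dots> = rF x0 - rF (xs (Suc k) w) + \<gamma> * noise_weight * (\<Sum>t\<le>k. (norm (err t w))\<^sup>2)"
    using sum_telescope[of "\<lambda>t. rF (xs t w)" k] by (simp add: sum.distrib sum_distrib_left xs_0)
  finally show ?thesis using rF_ge_INF[OF xs_in_edom, of "Suc k" w] by simp
qed

section \<open>Square integrability of errors, steps and gradient mappings\<close>

lemma
  assumes "t \<le> m" and err: "\<And>k. k \<le> t \<Longrightarrow> integrable Q (\<lambda>w. (norm (err k w))\<^sup>2)"
  shows step_integrable_aux: "integrable Q (\<lambda>w. (norm (step t w))\<^sup>2)"
    and gmap_integrable_aux: "integrable Q (\<lambda>w. (norm (gmap (xs t w)))\<^sup>2)"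
proof -
  interpret Q: prob_space Q by (rule prob_space_Q)
  let ?R = "\<lambda>w. gap + \<gamma> * noise_weight * (\<Sum>k\<le>t. (norm (err k w))\<^sup>2)"
  have R: "integrable Q ?R"
    by (intro Bochner_Integration.integrable_add Q.integrable_const integrable_mult_right
        Bochner_Integration.integrable_sum err) auto
  \<comment> \<open>Summed descent holds for every realization, so one nonnegative summand is
    dominated by \<open>?R\<close>, which involves errors up to t only.\<close>
  have le: "7 / 20 * L * \<gamma> * \<eta>\<^sup>2 * (norm (gmap (xs t w)))\<^sup>2 + 3 / 10 * \<gamma> * L * (norm (step t w))\<^sup>2 \<le> ?R w" for w
    by (rule order_trans[OF member_le_sum sum_descent]) (use \<gamma> L_pos in auto)
  have nn: "0 \<le> 3 / 10 * \<gamma> * L * (norm (step t w))\<^sup>2" "0 \<le> 7 / 20 * L * \<gamma> * \<eta>\<^sup>2 * (norm (gmap (xs t w)))\<^sup>2" for w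
    using \<gamma> L_pos by auto
  have norm_le: "norm (3 / 10 * \<gamma> * L * (norm (step t w))\<^sup>2) \<le> norm (?R w)"
      "norm (7 / 20 * L * \<gamma> * \<eta>\<^sup>2 * (norm (gmap (xs t w)))\<^sup>2) \<le> norm (?R w)" for w
    using le[of w] nn[of w] unfolding real_norm_def by linarith+
  have [measurable]: "step t \<in> borel_measurable Q"
    unfolding step_def using us_measurable xs_measurable \<open>t \<le> m\<close> by measurable
  have "integrable Q (\<lambda>w. 3 / 10 * \<gamma> * L * (norm (step t w))\<^sup>2)"
    by (rule Bochner_Integration.integrable_bound[OF R _ AE_I2[OF norm_le(1)]]) measurable
  then show "integrable Q (\<lambda>w. (norm (step t w))\<^sup>2)"
    using integrable_mult_left_iff[of Q "3 / 10 * \<gamma> * L" "\<lambda>w. (norm (step t w))\<^sup>2"] \<gamma> L_pos by auto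
  have [measurable]: "(\<lambda>w. gmap (xs t w)) \<in> borel_measurable Q" by (rule gmap_measurable[OF \<open>t \<le> m\<close>])
  have "integrable Q (\<lambda>w. 7 / 20 * L * \<gamma> * \<eta>\<^sup>2 * (norm (gmap (xs t w)))\<^sup>2)"
    by (rule Bochner_Integration.integrable_bound[OF R _ AE_I2[OF norm_le(2)]]) measurable
  then show "integrable Q (\<lambda>w. (norm (gmap (xs t w)))\<^sup>2)"
    using integrable_mult_left_iff[of Q "7 / 20 * L * \<gamma> * \<eta>\<^sup>2" "\<lambda>w. (norm (gmap (xs t w)))\<^sup>2"] \<gamma> L_pos \<eta>_pos
    by auto
qed

lemma err_step_integrable:
  assumes "t < m" "integrable Q (\<lambda>w. (norm (err t w))\<^sup>2)" "integrable Q (\<lambda>w. (norm (step t w))\<^sup>2)"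
  shows "integrable Q (\<lambda>w. (norm (err (Suc t) w))\<^sup>2)
    \<and> (\<integral>w. (norm (err (Suc t) w))\<^sup>2 \<partial>Q) \<le> \<beta>\<^sup>2 * (\<integral>w. (norm (err t w))\<^sup>2 \<partial>Q)
      + \<beta>\<^sup>2 * L\<^sup>2 * \<gamma>\<^sup>2 * (\<integral>w. (norm (step t w))\<^sup>2 \<partial>Q) + (1 - \<beta>)\<^sup>2 * \<sigma>\<^sup>2"
proof (rule integrable_nn_le)
  interpret Q: prob_space Q by (rule prob_space_Q)
  have "xs (Suc t) w - xs t w = \<gamma> *\<^sub>R step t w" for w
    by (simp add: xs_Suc step_def algebra_simps)
  then have eq: "\<beta>\<^sup>2 * (norm (err t w))\<^sup>2 + \<beta>\<^sup>2 * L\<^sup>2 * (norm (xs (Suc t) w - xs t w))\<^sup>2 + (1 - \<beta>)\<^sup>2 * \<sigma>\<^sup>2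
      = \<beta>\<^sup>2 * (norm (err t w))\<^sup>2 + \<beta>\<^sup>2 * L\<^sup>2 * \<gamma>\<^sup>2 * (norm (step t w))\<^sup>2 + (1 - \<beta>)\<^sup>2 * \<sigma>\<^sup>2" for w
    by (simp add: power_mult_distrib)
  have "(\<integral>\<^sup>+w. ennreal ((norm (err (Suc t) w))\<^sup>2) \<partial>Q)
      \<le> (\<integral>\<^sup>+w. ennreal (\<beta>\<^sup>2 * (norm (err t w))\<^sup>2 + \<beta>\<^sup>2 * L\<^sup>2 * \<gamma>\<^sup>2 * (norm (step t w))\<^sup>2 + (1 - \<beta>)\<^sup>2 * \<sigma>\<^sup>2) \<partial>Q)"
    using nn_integral_err_Suc[OF assms(1)] unfolding eq .
  also have "\<dots> = ennreal (\<integral>w. \<beta>\<^sup>2 * (norm (err t w))\<^sup>2 + \<beta>\<^sup>2 * L\<^sup>2 * \<gamma>\<^sup>2 * (norm (step t w))\<^sup>2 + (1 - \<beta>)\<^sup>2 * \<sigma>\<^sup>2 \<partial>Q)"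
    using assms by (intro nn_integral_eq_integral) auto
  also have "(\<integral>w. \<beta>\<^sup>2 * (norm (err t w))\<^sup>2 + \<beta>\<^sup>2 * L\<^sup>2 * \<gamma>\<^sup>2 * (norm (step t w))\<^sup>2 + (1 - \<beta>)\<^sup>2 * \<sigma>\<^sup>2 \<partial>Q)
      = \<beta>\<^sup>2 * (\<integral>w. (norm (err t w))\<^sup>2 \<partial>Q)
      + \<beta>\<^sup>2 * L\<^sup>2 * \<gamma>\<^sup>2 * (\<integral>w. (norm (step t w))\<^sup>2 \<partial>Q) + (1 - \<beta>)\<^sup>2 * \<sigma>\<^sup>2"
    using assms by (simp add: Q.prob_space)
  finally show "(\<integral>\<^sup>+w. ennreal ((norm (err (Suc t) w))\<^sup>2) \<partial>Q) \<le> ennreal (\<beta>\<^sup>2 * (\<integral>w. (norm (err t w))\<^sup>2 \<partial>Q)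
      + \<beta>\<^sup>2 * L\<^sup>2 * \<gamma>\<^sup>2 * (\<integral>w. (norm (step t w))\<^sup>2 \<partial>Q) + (1 - \<beta>)\<^sup>2 * \<sigma>\<^sup>2)" .
  have "err (Suc t) \<in> borel_measurable Q" using assms(1) by (intro err_measurable) simp
  then show "(\<lambda>w. (norm (err (Suc t) w))\<^sup>2) \<in> borel_measurable Q" by measurable
  show "0 \<le> \<beta>\<^sup>2 * (\<integral>w. (norm (err t w))\<^sup>2 \<partial>Q)
      + \<beta>\<^sup>2 * L\<^sup>2 * \<gamma>\<^sup>2 * (\<integral>w. (norm (step t w))\<^sup>2 \<partial>Q) + (1 - \<beta>)\<^sup>2 * \<sigma>\<^sup>2"
    by (intro add_nonneg_nonneg mult_nonneg_nonneg integral_nonneg_AE) auto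
qed simp

lemma err_0_integrable: "integrable Q (\<lambda>w. (norm (err 0 w))\<^sup>2) \<and> (\<integral>w. (norm (err 0 w))\<^sup>2 \<partial>Q) \<le> \<sigma>\<^sup>2 / real b"
proof (rule integrable_nn_le)
  have "err 0 \<in> borel_measurable Q" by (rule err_measurable) simp
  then show "(\<lambda>w. (norm (err 0 w))\<^sup>2) \<in> borel_measurable Q" by measurable
qed (auto intro: nn_integral_err_0)

text \<open>Integrability passes from the errors up to k to step k, and from there to error k + 1.
  The step is dominated by all errors so far, hence strong induction.\<close>

lemma err_integrable: "t \<le> m \<Longrightarrow> integrable Q (\<lambda>w. (norm (err t w))\<^sup>2)"
proof (induction t rule: less_induct)
  case (less t)
  show ?case
  proof (cases t)
    case 0
    then show ?thesis using err_0_integrable by simp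
  next
    case (Suc k)
    then have "integrable Q (\<lambda>w. (norm (step k w))\<^sup>2)"
      using less by (intro step_integrable_aux) auto
    with Suc less show ?thesis using err_step_integrable[of k] by simp
  qed
qed

lemma step_integrable: "t \<le> m \<Longrightarrow> integrable Q (\<lambda>w. (norm (step t w))\<^sup>2)"
  and gmap_integrable: "t \<le> m \<Longrightarrow> integrable Q (\<lambda>w. (norm (gmap (xs t w)))\<^sup>2)"
  by (auto intro!: step_integrable_aux gmap_integrable_aux err_integrable)

text \<open>The factor 5/7 is the reserve for the rounding in part (c). On the gap term it is used
  up exactly, 20/7 * 4 = 5/7 * 16; the noise term has room to spare.\<close>

lemma sum_gmap_le:
  assumes \<beta>_rate: "(1 - \<beta>)\<^sup>2 * (real b * (real m + 1)) = 1" and \<gamma>_rate: "\<gamma>\<^sup>2 = 9 * (1 - \<beta>) / 13"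
  shows "(\<Sum>t\<le>m. \<integral>w. (norm (gmap (xs t w)))\<^sup>2 \<partial>Q)
    \<le> 5 / 7 * (16 * L * gap / \<gamma> + 208 / 9 * \<sigma>\<^sup>2 / (real b * (1 - \<beta>)))"
proof -
  interpret Q: prob_space Q by (rule prob_space_Q)
  define G E D where "G = (\<Sum>t\<le>m. \<integral>w. (norm (gmap (xs t w)))\<^sup>2 \<partial>Q)"
    and "E = (\<Sum>t\<le>m. \<integral>w. (norm (err t w))\<^sup>2 \<partial>Q)" and "D = (\<Sum>t\<le>m. \<integral>w. (norm (step t w))\<^sup>2 \<partial>Q)"
  have "D \<ge> 0" unfolding D_def by (intro sum_nonneg integral_nonneg_AE) auto
  have "(\<integral>w. (\<Sum>t\<le>m. 7 / 20 * L * \<gamma> * \<eta>\<^sup>2 * (norm (gmap (xs t w)))\<^sup>2 + 3 / 10 * \<gamma> * L * (norm (step t w))\<^sup>2) \<partial>Q)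
      \<le> (\<integral>w. gap + \<gamma> * noise_weight * (\<Sum>t\<le>m. (norm (err t w))\<^sup>2) \<partial>Q)"
    by (intro integral_mono sum_descent Bochner_Integration.integrable_add Q.integrable_const
        integrable_mult_right Bochner_Integration.integrable_sum gmap_integrable step_integrable
        err_integrable) auto
  moreover have "(\<integral>w. (\<Sum>t\<le>m. 7 / 20 * L * \<gamma> * \<eta>\<^sup>2 * (norm (gmap (xs t w)))\<^sup>2 + 3 / 10 * \<gamma> * L * (norm (step t w))\<^sup>2) \<partial>Q)
      = (\<Sum>t\<le>m. \<integral>w. 7 / 20 * L * \<gamma> * \<eta>\<^sup>2 * (norm (gmap (xs t w)))\<^sup>2 + 3 / 10 * \<gamma> * L * (norm (step t w))\<^sup>2 \<partial>Q)"
    by (intro Bochner_Integration.integral_sum Bochner_Integration.integrable_add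
        integrable_mult_right gmap_integrable step_integrable) auto
  moreover have "\<dots> = (\<Sum>t\<le>m. 7 / 20 * L * \<gamma> * \<eta>\<^sup>2 * (\<integral>w. (norm (gmap (xs t w)))\<^sup>2 \<partial>Q)
      + 3 / 10 * \<gamma> * L * (\<integral>w. (norm (step t w))\<^sup>2 \<partial>Q))"
    by (intro sum.cong refl, subst Bochner_Integration.integral_add)
      (auto simp: gmap_integrable step_integrable)
  moreover have "(\<integral>w. gap + \<gamma> * noise_weight * (\<Sum>t\<le>m. (norm (err t w))\<^sup>2) \<partial>Q)
      = gap + \<gamma> * noise_weight * (\<Sum>t\<le>m. \<integral>w. (norm (err t w))\<^sup>2 \<partial>Q)"
    using Bochner_Integration.integrable_sum[of "{..m}" Q "\<lambda>t w. (norm (err t w))\<^sup>2"]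
      Bochner_Integration.integral_sum[of "{..m}" Q "\<lambda>t w. (norm (err t w))\<^sup>2"]
    by (simp add: err_integrable Q.prob_space)
  ultimately have descent: "7 / 20 * L * \<gamma> * \<eta>\<^sup>2 * G + 3 / 10 * \<gamma> * L * D \<le> gap + \<gamma> * noise_weight * E"
    by (simp add: G_def E_def D_def sum.distrib sum_distrib_left)
  have "E = (\<integral>w. (norm (err 0 w))\<^sup>2 \<partial>Q) + (\<Sum>t<m. \<integral>w. (norm (err (Suc t) w))\<^sup>2 \<partial>Q)"
    unfolding E_def by (simp add: sum.atMost_shift)
  also have "\<dots> \<le> \<sigma>\<^sup>2 / real b + (\<Sum>t<m. \<beta>\<^sup>2 * (\<integral>w. (norm (err t w))\<^sup>2 \<partial>Q)
      + \<beta>\<^sup>2 * L\<^sup>2 * \<gamma>\<^sup>2 * (\<integral>w. (norm (step t w))\<^sup>2 \<partial>Q) + (1 - \<beta>)\<^sup>2 * \<sigma>\<^sup>2)"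
    using err_0_integrable
    by (intro add_mono sum_mono err_step_integrable[THEN conjunct2] err_integrable step_integrable) auto
  also have "\<dots> = \<sigma>\<^sup>2 / real b + \<beta>\<^sup>2 * (\<Sum>t<m. \<integral>w. (norm (err t w))\<^sup>2 \<partial>Q)
      + \<beta>\<^sup>2 * L\<^sup>2 * \<gamma>\<^sup>2 * (\<Sum>t<m. \<integral>w. (norm (step t w))\<^sup>2 \<partial>Q) + real m * ((1 - \<beta>)\<^sup>2 * \<sigma>\<^sup>2)"
    by (simp add: sum.distrib sum_distrib_left)
  \<comment> \<open>The sums are extended by their last term. As (1 - \<beta>)^2 (m + 1) = 1 / b,
    the noise of all m iterations together costs no more than the initial batch.\<close>
  also have "\<dots> \<le> \<sigma>\<^sup>2 / real b + \<beta>\<^sup>2 * E + \<beta>\<^sup>2 * L\<^sup>2 * \<gamma>\<^sup>2 * D + \<sigma>\<^sup>2 / real b"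
  proof (intro add_mono mult_left_mono order.refl)
    show "(\<Sum>t<m. \<integral>w. (norm (err t w))\<^sup>2 \<partial>Q) \<le> E" "(\<Sum>t<m. \<integral>w. (norm (step t w))\<^sup>2 \<partial>Q) \<le> D"
      unfolding E_def D_def by (auto intro!: sum_mono2 integral_nonneg_AE)
    have "0 \<le> real b * (1 - \<beta>)\<^sup>2" by simp
    moreover have "real b * (1 - \<beta>)\<^sup>2 + real m * (1 - \<beta>)\<^sup>2 * real b = 1"
      using \<beta>_rate by (simp add: algebra_simps)
    ultimately have "real m * (1 - \<beta>)\<^sup>2 * real b \<le> 1" by linarith
    then have "real m * (1 - \<beta>)\<^sup>2 \<le> 1 / real b"
      using b_pos by (simp add: pos_le_divide_eq)
    then have "(real m * (1 - \<beta>)\<^sup>2) * \<sigma>\<^sup>2 \<le> 1 / real b * \<sigma>\<^sup>2" by (intro mult_right_mono) auto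
    then show "real m * ((1 - \<beta>)\<^sup>2 * \<sigma>\<^sup>2) \<le> \<sigma>\<^sup>2 / real b" by (simp add: mult.assoc)
  qed auto
  finally have "(1 - \<beta>) * ((1 + \<beta>) * E) \<le> 2 * \<sigma>\<^sup>2 / real b + \<beta>\<^sup>2 * L\<^sup>2 * (9 * (1 - \<beta>) / 13) * D"
    unfolding \<gamma>_rate by (simp add: algebra_simps power2_eq_square)
  also have "\<dots> = (1 - \<beta>) * (2 * \<sigma>\<^sup>2 / (real b * (1 - \<beta>)) + 9 / 13 * \<beta>\<^sup>2 * L\<^sup>2 * D)"
    using \<beta> b_pos by (simp add: field_simps)
  finally have E: "(1 + \<beta>) * E \<le> 2 * \<sigma>\<^sup>2 / (real b * (1 - \<beta>)) + 9 / 13 * \<beta>\<^sup>2 * L\<^sup>2 * D"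
    using \<beta> by simp
  define N where "N = 2 * \<sigma>\<^sup>2 / (real b * (1 - \<beta>))"
  have "N \<ge> 0" using \<beta> by (simp add: N_def)
  have "E \<le> N + 9 / 26 * L\<^sup>2 * D"
  proof -
    \<comment> \<open>Division by 1 - \<beta> has left the factor 1 + \<beta> in front of E. Since
      \<beta>^2 is below both 1 and \<beta>, it is below their mean; the factor cancels and 9/13
      becomes 9/26.\<close>
    have "\<beta>\<^sup>2 \<le> (1 + \<beta>) / 2"
      using \<beta> power_le_one[of \<beta> 2] mult_left_le[of \<beta> \<beta>] by (simp add: power2_eq_square)
    then have "\<beta>\<^sup>2 * (9 / 13 * L\<^sup>2 * D) \<le> (1 + \<beta>) / 2 * (9 / 13 * L\<^sup>2 * D)"
      using \<open>D \<ge> 0\<close> by (intro mult_right_mono) auto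
    moreover have "N \<le> (1 + \<beta>) * N" using \<open>N \<ge> 0\<close> \<beta> by (simp add: algebra_simps)
    moreover have "9 / 13 * \<beta>\<^sup>2 * L\<^sup>2 * D = \<beta>\<^sup>2 * (9 / 13 * L\<^sup>2 * D)" by simp
    moreover have "(1 + \<beta>) * (N + 9 / 26 * L\<^sup>2 * D) = (1 + \<beta>) * N + (1 + \<beta>) / 2 * (9 / 13 * L\<^sup>2 * D)"
      by (simp add: algebra_simps)
    ultimately have "(1 + \<beta>) * E \<le> (1 + \<beta>) * (N + 9 / 26 * L\<^sup>2 * D)"
      using E[folded N_def] by linarith
    then show ?thesis using \<beta> by simp
  qed
  then have "\<gamma> * noise_weight * E \<le> \<gamma> * noise_weight * (N + 9 / 26 * L\<^sup>2 * D)"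
    using \<gamma> noise_weight_nonneg by (intro mult_left_mono) auto
  also have "\<dots> = \<gamma> * noise_weight * N + \<gamma> * D * (9 / 26 * L\<^sup>2 * noise_weight)"
    by (simp add: algebra_simps)
  \<comment> \<open>L \<eta> <= 2/3 bounds \<open>noise_weight\<close> by (1/2 + 7/10 * 4/9) / L =
    73 / (90 L), and 9/26 * 73/90 < 3/10: the reserved step term suffices.\<close>
  also have "9 / 26 * L\<^sup>2 * noise_weight \<le> 3 / 10 * L"
  proof -
    have "\<eta>\<^sup>2 \<le> (2 / (3 * L))\<^sup>2" using \<eta>_bounds \<eta>_pos by (intro power_mono) auto
    then have "L * \<eta>\<^sup>2 \<le> L * (2 / (3 * L))\<^sup>2" using L_pos by (intro mult_left_mono) auto
    then have "noise_weight \<le> 73 / 90 / L"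
      using L_pos by (simp add: noise_weight_def power2_eq_square field_simps)
    then have "9 / 26 * L\<^sup>2 * noise_weight \<le> 9 / 26 * L\<^sup>2 * (73 / 90 / L)"
      by (intro mult_left_mono) auto
    also have "\<dots> \<le> 3 / 10 * L" using L_pos by (simp add: power2_eq_square field_simps)
    finally show ?thesis .
  qed
  finally have "\<gamma> * noise_weight * E \<le> \<gamma> * noise_weight * N + \<gamma> * D * (3 / 10 * L)"
    using \<gamma> \<open>D \<ge> 0\<close> by (simp add: mult_left_mono)
  with descent have "7 / 20 * L * \<gamma> * \<eta>\<^sup>2 * G \<le> gap + \<gamma> * noise_weight * N"
    by (simp add: algebra_simps)
  then have "L * \<gamma> * \<eta>\<^sup>2 * G \<le> 20 / 7 * (gap + \<gamma> * noise_weight * N)" by simp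
  then have "G \<le> 20 / 7 * (gap + \<gamma> * noise_weight * N) / (L * \<gamma> * \<eta>\<^sup>2)"
    using \<gamma> L_pos \<eta>_pos by (simp add: pos_le_divide_eq mult.commute)
  also have "\<dots> = 20 / 7 * (gap / (L * \<gamma>) * (1 / \<eta>\<^sup>2) + N * (1 / (2 * L\<^sup>2) * (1 / \<eta>\<^sup>2) + 7 / 10))"
    using \<gamma> L_pos \<eta>_pos by (simp add: noise_weight_def field_simps power2_eq_square)
  also have "\<dots> \<le> 20 / 7 * (gap / (L * \<gamma>) * (4 * L\<^sup>2) + N * (1 / (2 * L\<^sup>2) * (4 * L\<^sup>2) + 7 / 10))"
  proof -
    have "1 / \<eta> \<le> 2 * L" using \<eta>_bounds(1) \<eta>_pos L_pos by (simp add: field_simps)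
    then have "(1 / \<eta>)\<^sup>2 \<le> (2 * L)\<^sup>2" using \<eta>_pos by (intro power_mono) auto
    then have le: "1 / \<eta>\<^sup>2 \<le> 4 * L\<^sup>2" by (simp add: power_divide power_mult_distrib)
    have "gap \<ge> 0" using rF_ge_INF[OF x0] by simp
    with le show ?thesis
      using \<gamma> L_pos \<open>N \<ge> 0\<close> by (intro mult_left_mono add_mono order.refl) auto
  qed
  also have "\<dots> = 5 / 7 * (16 * L * gap / \<gamma>) + 54 / 7 * N"
    using \<gamma> L_pos by (simp add: field_simps power2_eq_square)
  \<comment> \<open>54/7 is 20/7 * (2 + 7/10), and \<open>N\<close> carries a further factor 2;
    108/7 is below 5/7 * 208/9.\<close>
  also have "54 / 7 * N \<le> 5 / 7 * (208 / 9 * \<sigma>\<^sup>2 / (real b * (1 - \<beta>)))"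
  proof -
    define K where "K = \<sigma>\<^sup>2 / (real b * (1 - \<beta>))"
    have "K \<ge> 0" using \<beta> by (simp add: K_def)
    then have "54 / 7 * (2 * K) \<le> 5 / 7 * (208 / 9 * K)" by simp
    then show ?thesis by (simp add: N_def K_def)
  qed
  finally show ?thesis by (simp add: G_def algebra_simps)
qed

text \<open>A full proximal step with the exact gradient cannot lower F by more than the gap. This
  handles m = 0 in part (c), where the averaged bound is too weak.\<close>

lemma gmap_x0_le: "(norm (gmap x0))\<^sup>2 \<le> 8 / 3 * L * gap"
proof -
  define u where "u = prox \<eta> \<psi> (x0 - \<eta> *\<^sub>R grad_f x0)"
  have "u \<in> edom F" using prox_in_edom[OF \<psi> \<eta>_pos] by (simp add: u_def edom_F_eq)
  have "rF u \<le> rF x0 + (L / 2 - 1 / \<eta>) * (norm (u - x0))\<^sup>2"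
    using prox_step(2)[OF x0 \<eta>_pos, of 1 "grad_f x0"] by (simp add: u_def)
  with rF_ge_INF[OF \<open>u \<in> edom F\<close>] have "(1 / \<eta> - L / 2) * (norm (u - x0))\<^sup>2 \<le> gap"
    by (simp add: algebra_simps)
  moreover have "(norm (u - x0))\<^sup>2 = \<eta>\<^sup>2 * (norm (gmap x0))\<^sup>2"
    using \<eta>_pos by (simp add: grad_mapping_def u_def norm_minus_commute power_mult_distrib[symmetric])
  moreover have "(1 / \<eta> - L / 2) * (\<eta>\<^sup>2 * (norm (gmap x0))\<^sup>2) = (\<eta> * (1 - L * \<eta> / 2)) * (norm (gmap x0))\<^sup>2"
    using \<eta>_pos by (simp add: field_simps power2_eq_square)
  ultimately have 1: "(\<eta> * (1 - L * \<eta> / 2)) * (norm (gmap x0))\<^sup>2 \<le> gap" by simp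
  have "3 / (8 * L) \<le> \<eta> * (1 - L * \<eta> / 2)"
  proof -
    have "1 / 2 \<le> L * \<eta>" "L * \<eta> \<le> 2 / 3"
      using \<eta>_bounds L_pos by (simp_all add: field_simps)
    \<comment> \<open>With s = L \<eta>, the product (s - 1/2) (3/2 - s) is twice s (1 - s/2) -
      3/8.\<close>
    then have "0 \<le> (L * \<eta> - 1 / 2) * (3 / 2 - L * \<eta>)" by (intro mult_nonneg_nonneg) auto
    then have "3 / 8 \<le> L * (\<eta> * (1 - L * \<eta> / 2))" by (simp add: algebra_simps)
    then show ?thesis using L_pos by (simp add: field_simps)
  qed
  then have "3 / (8 * L) * (norm (gmap x0))\<^sup>2 \<le> (\<eta> * (1 - L * \<eta> / 2)) * (norm (gmap x0))\<^sup>2"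
    by (rule mult_right_mono) simp
  with 1 have "3 / (8 * L) * (norm (gmap x0))\<^sup>2 \<le> gap" by linarith
  then show ?thesis using L_pos by (simp add: field_simps)
qed

section \<open>Random output and rates\<close>

text \<open>Independence makes the joint law of index and sample vector the product of the uniform
  law and \<open>Q\<close>, so Tonelli turns the expectation at the random index into an average
  over t.\<close>

lemma
  fixes M :: "'w measure" and X :: "hsgd_sample \<Rightarrow> 'w \<Rightarrow> 's" and idx :: "'w \<Rightarrow> nat"
  assumes M: "prob_space M"
    and samples_indep: "prob_space.indep_vars M (\<lambda>_. P) X samples"
    and samples_distr: "\<And>i. i \<in> samples \<Longrightarrow> distr M P (X i) = P"
    and idx_range: "idx \<in> space M \<rightarrow> {..m}"
    and idx_distr: "distr M (count_space UNIV) idx = measure_pmf (pmf_of_set {..m})"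
    and idx_indep: "prob_space.indep_set M
         (sets (vimage_algebra (space M) idx (count_space UNIV)))
         (sets (vimage_algebra (space M) (\<lambda>\<omega>. \<lambda>i\<in>samples. X i \<omega>) Q))"
  shows gmap_output_integrable:
      "integrable M (\<lambda>\<omega>. (norm (gmap (iterate (state (\<lambda>i. X i \<omega>) (idx \<omega>)))))\<^sup>2)"
    and gmap_output_mean:
      "(\<integral>\<omega>. (norm (gmap (iterate (state (\<lambda>i. X i \<omega>) (idx \<omega>)))))\<^sup>2 \<partial>M)
        = (\<Sum>t\<le>m. \<integral>w. (norm (gmap (xs t w)))\<^sup>2 \<partial>Q) / (real m + 1)"
proof -
  interpret M: prob_space M by fact
  interpret Q: prob_space Q by (rule prob_space_Q)
  define W where "W = (\<lambda>\<omega>. \<lambda>i\<in>samples. X i \<omega>)"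
  have W: "W \<in> measurable M Q"
    unfolding W_def using samples_indep by (intro measurable_restrict) (auto simp: M.indep_vars_def)
  \<comment> \<open>Independence of the generated families includes that their members are events,
    which is measurability of \<open>idx\<close>.\<close>
  have idx: "idx \<in> measurable M (count_space UNIV)"
  proof (rule measurableI)
    fix A :: "nat set"
    have "idx -` A \<inter> space M \<in> sets (vimage_algebra (space M) idx (count_space UNIV))"
      by (intro in_vimage_algebra) simp
    then show "idx -` A \<inter> space M \<in> sets M"
      using M.indep_setD_ev1[OF idx_indep] by auto
  qed simp
  have pair: "distr M (count_space UNIV) idx \<Otimes>\<^sub>M distr M Q W
      = distr M (count_space UNIV \<Otimes>\<^sub>M Q) (\<lambda>\<omega>. (idx \<omega>, W \<omega>))"
  proof (rule pair_measure_eqI)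
    show "sigma_finite_measure (distr M (count_space UNIV) idx)" "sigma_finite_measure (distr M Q W)"
      using M.prob_space_distr[OF idx] M.prob_space_distr[OF W]
      by (auto intro: prob_space_imp_sigma_finite)
    show "sets (distr M (count_space UNIV) idx \<Otimes>\<^sub>M distr M Q W)
        = sets (distr M (count_space UNIV \<Otimes>\<^sub>M Q) (\<lambda>\<omega>. (idx \<omega>, W \<omega>)))"
      unfolding sets_distr by (intro sets_pair_measure_cong) simp_all
    fix A B assume "A \<in> sets (distr M (count_space UNIV) idx)" "B \<in> sets (distr M Q W)"
    then have B: "B \<in> sets Q" by simp
    have "(\<lambda>\<omega>. (idx \<omega>, W \<omega>)) -` (A \<times> B) \<inter> space M = (idx -` A \<inter> space M) \<inter> (W -` B \<inter> space M)"
      by auto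
    moreover have "M.prob ((idx -` A \<inter> space M) \<inter> (W -` B \<inter> space M))
        = M.prob (idx -` A \<inter> space M) * M.prob (W -` B \<inter> space M)"
      by (rule M.indep_setD[OF idx_indep[folded W_def]]) (auto intro!: in_vimage_algebra B)
    ultimately show "emeasure (distr M (count_space UNIV) idx) A * emeasure (distr M Q W) B
        = emeasure (distr M (count_space UNIV \<Otimes>\<^sub>M Q) (\<lambda>\<omega>. (idx \<omega>, W \<omega>))) (A \<times> B)"
      using B idx W
      by (simp add: emeasure_distr M.emeasure_eq_measure ennreal_mult measurable_Pair pair_measureI)
  qed
  have distr_W: "distr M Q W = Q"
  proof -
    \<comment> \<open>Supplies the nonempty index set for the characterization of independence by
      the product law.\<close>
    have "Batch 0 \<in> samples" using b_pos by (auto simp: hsgd_samples_def)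
    then have "distr M Q W = PiM samples (\<lambda>i. distr M P (X i))"
      unfolding W_def
      using M.indep_vars_iff_distr_eq_PiM'[where I=samples and M'="\<lambda>_. P" and X=X] samples_indep
      by (auto simp: M.indep_vars_def)
    also have "\<dots> = Q" by (intro PiM_cong refl samples_distr)
    finally show ?thesis .
  qed
  \<comment> \<open>Cut off beyond m, since the later iterates read samples outside the coordinates
    of \<open>Q\<close>; the random index never exceeds m.\<close>
  define h where "h = (\<lambda>(k, w). if k \<le> m then (norm (gmap (xs k w)))\<^sup>2 else 0)"
  have h_meas: "h \<in> borel_measurable (count_space UNIV \<Otimes>\<^sub>M Q)"
  proof (rule measurable_pair_measure_countable1)
    fix k
    show "(\<lambda>w. h (k, w)) \<in> borel_measurable Q"
      using gmap_measurable[of k] by (cases "k \<le> m") (simp_all add: h_def)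
  qed simp
  have h_eq: "(norm (gmap (iterate (state (\<lambda>i. X i \<omega>) (idx \<omega>)))))\<^sup>2 = h (idx \<omega>, W \<omega>)"
    if "\<omega> \<in> space M" for \<omega>
  proof -
    have k: "idx \<omega> \<le> m" using idx_range that by auto
    then have "hsgd_samples b (idx \<omega>) \<subseteq> samples" by (auto simp: hsgd_samples_def)
    then have "state (\<lambda>i. X i \<omega>) (idx \<omega>) = state (W \<omega>) (idx \<omega>)"
      by (intro proxHSGD_cong) (auto simp: W_def)
    with k show ?thesis by (simp add: h_def xs_def)
  qed
  have meas: "(\<lambda>\<omega>. h (idx \<omega>, W \<omega>)) \<in> borel_measurable M"
    using measurable_compose[OF measurable_Pair[OF idx W] h_meas] .
  define S where "S = (\<Sum>t\<le>m. \<integral>w. (norm (gmap (xs t w)))\<^sup>2 \<partial>Q)"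
  have "S \<ge> 0" unfolding S_def by (intro sum_nonneg integral_nonneg_AE) auto
  have "(\<integral>\<^sup>+\<omega>. ennreal (h (idx \<omega>, W \<omega>)) \<partial>M)
      = (\<integral>\<^sup>+z. ennreal (h z) \<partial>(measure_pmf (pmf_of_set {..m}) \<Otimes>\<^sub>M Q))"
    using pair[unfolded distr_W idx_distr] h_meas idx W
    by (simp add: nn_integral_distr)
  also have "\<dots> = (\<integral>\<^sup>+k. (\<integral>\<^sup>+w. ennreal (h (k, w)) \<partial>Q) \<partial>measure_pmf (pmf_of_set {..m}))"
  proof (rule Q.nn_integral_fst[symmetric])
    have "sets (measure_pmf (pmf_of_set {..m}) \<Otimes>\<^sub>M Q) = sets (count_space UNIV \<Otimes>\<^sub>M Q)"
      by (intro sets_pair_measure_cong) auto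
    then have "h \<in> borel_measurable (measure_pmf (pmf_of_set {..m}) \<Otimes>\<^sub>M Q)"
      using h_meas by (simp cong: measurable_cong_sets)
    then show "(\<lambda>z. ennreal (h z)) \<in> borel_measurable (measure_pmf (pmf_of_set {..m}) \<Otimes>\<^sub>M Q)"
      by measurable
  qed
  also have "\<dots> = (\<Sum>k\<le>m. (\<integral>\<^sup>+w. ennreal (h (k, w)) \<partial>Q)) / ennreal (real m + 1)"
    by (subst nn_integral_pmf_of_set) (auto simp: ennreal_of_nat_eq_real_of_nat add.commute)
  also have "(\<Sum>k\<le>m. (\<integral>\<^sup>+w. ennreal (h (k, w)) \<partial>Q))
      = (\<Sum>k\<le>m. ennreal (\<integral>w. (norm (gmap (xs k w)))\<^sup>2 \<partial>Q))"
    by (intro sum.cong refl) (auto simp: h_def nn_integral_eq_integral gmap_integrable)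
  also have "\<dots> = ennreal S"
    unfolding S_def by (rule sum_ennreal) (auto intro!: integral_nonneg_AE)
  also have "ennreal S / ennreal (real m + 1) = ennreal (S / (real m + 1))"
    using \<open>S \<ge> 0\<close> by (intro divide_ennreal) auto
  finally have nn: "(\<integral>\<^sup>+\<omega>. ennreal (h (idx \<omega>, W \<omega>)) \<partial>M) = ennreal (S / (real m + 1))" .
  have h_nonneg: "0 \<le> h z" for z by (auto simp: h_def split: prod.split)
  have "has_bochner_integral M (\<lambda>\<omega>. h (idx \<omega>, W \<omega>)) (S / (real m + 1))"
    using meas h_nonneg \<open>S \<ge> 0\<close> nn by (intro has_bochner_integral_nn_integral) auto
  then have "has_bochner_integral M (\<lambda>\<omega>. (norm (gmap (iterate (state (\<lambda>i. X i \<omega>) (idx \<omega>)))))\<^sup>2) (S / (real m + 1))"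
    by (rule has_bochner_integral_cong[THEN iffD1, rotated -1]) (auto simp: h_eq)
  then show "integrable M (\<lambda>\<omega>. (norm (gmap (iterate (state (\<lambda>i. X i \<omega>) (idx \<omega>)))))\<^sup>2)"
    and "(\<integral>\<omega>. (norm (gmap (iterate (state (\<lambda>i. X i \<omega>) (idx \<omega>)))))\<^sup>2 \<partial>M)
        = (\<Sum>t\<le>m. \<integral>w. (norm (gmap (xs t w)))\<^sup>2 \<partial>Q) / (real m + 1)"
    by (auto simp: has_bochner_integral_iff S_def)
qed

end

section \<open>Closed forms of the rate and of the iteration count\<close>

lemma hsgd_rate_eq:
  fixes b N L \<sigma> g :: real
  assumes b: "b > 0" and N: "N > 0" and \<beta>: "\<beta> = 1 - 1 / sqrt (b * N)"
    and \<gamma>: "\<gamma> = 3 / (sqrt 13 * (b * N) powr (1/4))"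
  shows "(16 * L * g / \<gamma> + 208 / 9 * \<sigma>\<^sup>2 / (b * (1 - \<beta>))) / N
    = 16 * sqrt 13 * L * b powr (1/4) / (3 * N powr (3/4)) * g + 208 * \<sigma>\<^sup>2 / (9 * sqrt (b * N))"
proof -
  have "N powr (1/4) / N = 1 / N powr (3/4)"
  proof -
    have "N powr (1/4) * N powr (3/4) = N" using N by (simp add: powr_add[symmetric])
    then show ?thesis using N by (simp add: field_simps)
  qed
  moreover have "16 * L * g / \<gamma> / N = 16 * sqrt 13 * L * b powr (1/4) / 3 * g * (N powr (1/4) / N)"
    using b N by (simp add: \<gamma> powr_mult)
  moreover have "1 / (b * (1 - \<beta>)) / N = 1 / sqrt (b * N)"
  proof -
    have "sqrt (b * N) * sqrt (b * N) = b * N" using b N by simp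
    then show ?thesis using b N by (simp add: \<beta> field_simps)
  qed
  then have "208 / 9 * \<sigma>\<^sup>2 / (b * (1 - \<beta>)) / N = 208 * \<sigma>\<^sup>2 / (9 * sqrt (b * N))"
    by (simp add: field_simps)
  ultimately show ?thesis by (simp add: add_divide_distrib)
qed

lemma hsgd_rate_batch_eq:
  fixes b N L \<sigma> g c :: real
  assumes N: "N > 0" and c: "c > 0" and b: "b = c\<^sup>2 * N powr (1/3)"
  shows "16 * sqrt 13 * L * b powr (1/4) / (3 * N powr (3/4)) * g + 208 * \<sigma>\<^sup>2 / (9 * sqrt (b * N))
    = (16 * sqrt (13 * c) * L / 3 * g + 208 * \<sigma>\<^sup>2 / (9 * c)) / N powr (2/3)"
proof -
  have "b powr (1/4) = sqrt c * N powr (1/12)"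
  proof -
    have "(c\<^sup>2) powr (1/4) = (c powr 2) powr (1/4)" using c by simp
    also have "\<dots> = sqrt c" using c by (simp only: powr_powr) (simp add: powr_half_sqrt)
    finally show ?thesis using N c unfolding b by (simp add: powr_mult powr_powr)
  qed
  moreover have "N powr (3/4) = N powr (1/12) * N powr (2/3)"
    by (simp add: powr_add[symmetric])
  moreover have "sqrt (b * N) = c * N powr (2/3)"
  proof (rule real_sqrt_unique)
    have "(N powr (2/3))\<^sup>2 = N powr (1/3) * N powr 1"
      by (simp only: power2_eq_square powr_add[symmetric]) simp
    then show "(c * N powr (2/3))\<^sup>2 = b * N"
      using N by (simp add: b power_mult_distrib)
  qed (use c in simp)
  ultimately show ?thesis
    using N c by (simp add: real_sqrt_mult add_divide_distrib mult_ac)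
qed

text \<open>Turns an iteration count into an accuracy: \<open>y\<close> will be the upper bound
  provided by the floor, m + 1 or m + 2.\<close>

lemma le_powr_two_thirds:
  fixes \<Delta> \<epsilon> y :: real
  assumes "0 \<le> \<Delta>" "0 < \<epsilon>" and le: "\<Delta> powr (3/2) / \<epsilon> ^ 3 \<le> y"
  shows "\<Delta> \<le> y powr (2/3) * \<epsilon>\<^sup>2"
proof -
  have "0 \<le> \<Delta> powr (3/2) / \<epsilon> ^ 3" using assms by simp
  with le have "0 \<le> y" by linarith
  have "\<Delta> = (\<Delta> powr (3/2)) powr (2/3)" using assms(1) by (simp add: powr_powr)
  also have "\<dots> \<le> (y * \<epsilon> ^ 3) powr (2/3)"
    using le \<open>0 < \<epsilon>\<close> by (intro powr_mono2) (auto simp: field_simps)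
  also have "\<dots> = y powr (2/3) * (\<epsilon> powr 3) powr (2/3)"
    using \<open>0 \<le> y\<close> \<open>0 < \<epsilon>\<close> by (simp add: powr_mult)
  also have "(\<epsilon> powr 3) powr (2/3) = \<epsilon>\<^sup>2" using \<open>0 < \<epsilon>\<close> by (simp only: powr_powr) simp
  finally show ?thesis .
qed

text \<open>Part (c) covers both readings of the count: m loop iterations, without the initial
  proximal operation, and m + 1 with it. The gradient count is attached to the second, where m + 1
  <= \<Delta>0^(3/2) / \<epsilon>^3 also controls b. Assuming \<open>b * (m + 1) > 1\<close>
  excludes b = 1, m = 0, which would give \<beta> = 0.\<close>

theorem theorem1:
  fixes P :: "'s measure" and M :: "'w measure"
    and fs :: "'s \<Rightarrow> 'a::euclidean_space \<Rightarrow> real"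
    and f F \<psi> :: "'a \<Rightarrow> ereal" and grad_f :: "'a \<Rightarrow> 'a"
    and L \<sigma> \<beta> \<gamma> \<eta> Fgap :: real
    and b m :: nat and x0 :: 'a
    and X :: "hsgd_sample \<Rightarrow> 'w \<Rightarrow> 's" and idx :: "'w \<Rightarrow> nat"
    and run :: "'w \<Rightarrow> nat \<Rightarrow> 'a hsgd_state" and xbar :: "'w \<Rightarrow> 'a"
  assumes f_eq: "f = mean_fun P fs"
    and grad_f_eq: "grad_f = grad (\<lambda>x. real_of_ereal (f x))"
    and F_eq: "F = (\<lambda>x. f x + \<psi> x)"
    and P: "prob_space P"
    and meas_fs: "\<And>x. (\<lambda>s. fs s x) \<in> borel_measurable P"
    and smooth_fs: "\<And>s x. s \<in> space P \<Longrightarrow> fs s differentiable (at x)"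
      "\<And>s. s \<in> space P \<Longrightarrow> continuous_on UNIV (grad (fs s))"
    and diff_f: "open (edom f)"
      "\<And>x. x \<in> edom f \<Longrightarrow> (\<lambda>y. real_of_ereal (f y)) differentiable (at x)"
    and unbiased: "\<And>x. x \<in> edom f \<Longrightarrow> integrable P (\<lambda>s. grad (fs s) x)"
      "\<And>x. x \<in> edom f \<Longrightarrow> (\<integral>s. grad (fs s) x \<partial>P) = grad_f x"
    and A1: "proper_fun \<psi>" "closed_fun \<psi>" "convex_fun \<psi>"
      "edom F \<noteq> {}" "(INF x. F x) > -\<infinity>"
    and A2: "L > 0"
      "\<And>x y. x \<in> edom F \<Longrightarrow> y \<in> edom F \<Longrightarrow>
         (\<integral>\<^sup>+s. ennreal ((norm (grad (fs s) x - grad (fs s) y))\<^sup>2) \<partial>P)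
           \<le> ennreal (L\<^sup>2 * (norm (x - y))\<^sup>2)"
    and A3: "\<sigma> \<ge> 0"
      "\<And>x. x \<in> edom F \<Longrightarrow>
         (\<integral>\<^sup>+s. ennreal ((norm (grad (fs s) x - grad_f x))\<^sup>2) \<partial>P) \<le> ennreal (\<sigma>\<^sup>2)"
    and b: "b > 0" "b * (m + 1) > 1"
    and beta_eq: "\<beta> = 1 - 1 / sqrt (real b * (real m + 1))"
    and gamma_eq: "\<gamma> = 3 / (sqrt 13 * (real b * (real m + 1)) powr (1/4))"
    and eta_eq: "\<eta> = 2 / ((3 + \<gamma>) * L)"
    and x0: "x0 \<in> edom F"
    and Fgap_eq: "Fgap = real_of_ereal (F x0) - real_of_ereal (INF x. F x)"
    and M: "prob_space M"
    and samples_indep: "prob_space.indep_vars M (\<lambda>_. P) X (hsgd_samples b m)"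
    and samples_distr: "\<And>i. i \<in> hsgd_samples b m \<Longrightarrow> distr M P (X i) = P"
    and run_eq: "run = (\<lambda>\<omega>. proxHSGD (\<lambda>s. grad (fs s)) \<psi> b (\<lambda>_. \<beta>) (\<lambda>_. \<gamma>) (\<lambda>_. \<eta>) x0
                              (\<lambda>i. X i \<omega>))"
    and idx_range: "idx \<in> space M \<rightarrow> {..m}"
    and idx_distr: "distr M (count_space UNIV) idx = measure_pmf (pmf_of_set {..m})"
    and idx_indep: "prob_space.indep_set M
         (sets (vimage_algebra (space M) idx (count_space UNIV)))
         (sets (vimage_algebra (space M) (\<lambda>\<omega>. \<lambda>i\<in>hsgd_samples b m. X i \<omega>)
                  (PiM (hsgd_samples b m) (\<lambda>_. P))))"
    and xbar_eq: "xbar = (\<lambda>\<omega>. iterate (run \<omega> (idx \<omega>)))"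
  shows
    "(\<beta> \<in> {0<..<1} \<and> \<gamma> \<in> {0<..<1} \<and> 1 / (2 * L) \<le> \<eta> \<and> \<eta> \<le> 2 / (3 * L))
     \<and>
     (integrable M (\<lambda>\<omega>. (norm (grad_mapping \<eta> \<psi> grad_f (xbar \<omega>)))\<^sup>2) \<and>
      (\<integral>\<omega>. (norm (grad_mapping \<eta> \<psi> grad_f (xbar \<omega>)))\<^sup>2 \<partial>M)
        \<le> 16 * sqrt 13 * L * real b powr (1/4) / (3 * (real m + 1) powr (3/4)) * Fgap
          + 208 * \<sigma>\<^sup>2 / (9 * sqrt (real b * (real m + 1))))
     \<and>
     (\<forall>c1 \<Delta>0 :: real.
        c1 \<ge> 1 / (real m + 1) powr (2/3) \<and>
        real b = c1\<^sup>2 * (real m + 1) powr (1/3) \<and>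
        \<Delta>0 = 16 * sqrt (13 * c1) * L / 3 * Fgap + 208 * \<sigma>\<^sup>2 / (9 * c1) \<longrightarrow>
        (\<integral>\<omega>. (norm (grad_mapping \<eta> \<psi> grad_f (xbar \<omega>)))\<^sup>2 \<partial>M)
          \<le> \<Delta>0 / (real m + 1) powr (2/3) \<and>
        (\<forall>\<epsilon>>0.
          (int m = \<lfloor>\<Delta>0 powr (3/2) / \<epsilon> ^ 3\<rfloor> \<longrightarrow>
             (\<integral>\<omega>. (norm (grad_mapping \<eta> \<psi> grad_f (xbar \<omega>)))\<^sup>2 \<partial>M) \<le> \<epsilon>\<^sup>2 \<and>
             (\<forall>\<omega>. int (prox_calls (run \<omega> m)) - int (prox_calls (run \<omega> 0))
                    = \<lfloor>\<Delta>0 powr (3/2) / \<epsilon> ^ 3\<rfloor>)) \<and>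
          (int m + 1 = \<lfloor>\<Delta>0 powr (3/2) / \<epsilon> ^ 3\<rfloor> \<longrightarrow>
             (\<integral>\<omega>. (norm (grad_mapping \<eta> \<psi> grad_f (xbar \<omega>)))\<^sup>2 \<partial>M) \<le> \<epsilon>\<^sup>2 \<and>
             (\<forall>\<omega>. int (prox_calls (run \<omega> m)) = \<lfloor>\<Delta>0 powr (3/2) / \<epsilon> ^ 3\<rfloor> \<and>
                  int (grad_calls (run \<omega> m))
                    \<le> \<lfloor>c1\<^sup>2 * \<Delta>0 powr (1/2) / \<epsilon> + 3 * \<Delta>0 powr (3/2) / \<epsilon> ^ 3\<rfloor>))))"
proof -
  define N where "N = real m + 1"
  have N: "N \<ge> 1" by (simp add: N_def)
  have "real 1 < real (b * (m + 1))" using b(2) by (subst of_nat_less_iff)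
  then have bN: "real b * N > 1" by (simp add: N_def algebra_simps)
  define q where "q = (real b * N) powr (1/4)"
  have q: "q > 0" using b(1) N by (simp add: q_def)
  have "q > 1" unfolding q_def using bN by (intro gr_one_powr) auto
  have q2: "q\<^sup>2 = sqrt (real b * N)"
    using bN unfolding q_def by (simp only: power2_eq_square powr_add[symmetric]) (simp add: powr_half_sqrt)
  have sqrt_gt: "sqrt (real b * N) > 1" using bN by simp
  have \<beta>_strict: "0 < \<beta>" "\<beta> < 1"
    using sqrt_gt bN unfolding beta_eq N_def[symmetric] by (auto simp: field_simps)
  have \<gamma>_q: "\<gamma> = 3 / (sqrt 13 * q)" by (simp add: gamma_eq q_def N_def)
  have \<gamma>_strict: "0 < \<gamma>" "\<gamma> < 1"
  proof -
    show "0 < \<gamma>" using q by (simp add: \<gamma>_q)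
    have "(3::real) < sqrt 13" by (rule real_less_rsqrt) simp
    also have "sqrt 13 * 1 < sqrt 13 * q" using \<open>q > 1\<close> by (intro mult_strict_left_mono) auto
    finally show "\<gamma> < 1" using q by (simp add: \<gamma>_q field_simps)
  qed
  interpret hsgd P fs f F \<psi> grad_f L \<sigma> \<beta> \<gamma> \<eta> b m x0
    unfolding hsgd_def hsgd_axioms_def stochastic_composite_def stochastic_composite_axioms_def
    using assms \<beta>_strict \<gamma>_strict by (intro conjI allI impI) (auto simp only: less_imp_le)
  have gap: "Fgap = gap" by (simp add: Fgap_eq)
  have gap_nonneg: "Fgap \<ge> 0" using rF_ge_INF[OF x0] by (simp add: gap)
  have \<beta>_rate: "(1 - \<beta>)\<^sup>2 * (real b * (real m + 1)) = 1"
    using b(1) N unfolding beta_eq N_def[symmetric] by (simp add: power_divide)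
  have \<gamma>_rate: "\<gamma>\<^sup>2 = 9 * (1 - \<beta>) / 13"
    unfolding \<gamma>_q power_divide power_mult_distrib q2 beta_eq N_def[symmetric] by simp
  define I where "I = (\<integral>\<omega>. (norm (grad_mapping \<eta> \<psi> grad_f (xbar \<omega>)))\<^sup>2 \<partial>M)"
  note out = gmap_output_integrable[OF M samples_indep samples_distr idx_range idx_distr idx_indep]
    gmap_output_mean[OF M samples_indep samples_distr idx_range idx_distr idx_indep]
  have int: "integrable M (\<lambda>\<omega>. (norm (grad_mapping \<eta> \<psi> grad_f (xbar \<omega>)))\<^sup>2)"
    unfolding xbar_eq run_eq by (rule out(1))
  have I_eq: "I = (\<Sum>t\<le>m. \<integral>w. (norm (gmap (xs t w)))\<^sup>2 \<partial>Q) / N"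
    unfolding I_def xbar_eq run_eq N_def by (rule out(2))
  define R where "R = 16 * sqrt 13 * L * real b powr (1/4) / (3 * (real m + 1) powr (3/4)) * Fgap
          + 208 * \<sigma>\<^sup>2 / (9 * sqrt (real b * (real m + 1)))"
  have "R \<ge> 0" using gap_nonneg L_pos by (simp add: R_def)
  have I_le: "I \<le> 5 / 7 * R"
  proof -
    have "I \<le> 5 / 7 * (16 * L * gap / \<gamma> + 208 / 9 * \<sigma>\<^sup>2 / (real b * (1 - \<beta>))) / N"
      unfolding I_eq using sum_gmap_le[OF \<beta>_rate \<gamma>_rate] N by (intro divide_right_mono) auto
    also have "\<dots> = 5 / 7 * ((16 * L * gap / \<gamma> + 208 / 9 * \<sigma>\<^sup>2 / (real b * (1 - \<beta>))) / N)"
      by (rule times_divide_eq_right[symmetric])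
    also have "(16 * L * gap / \<gamma> + 208 / 9 * \<sigma>\<^sup>2 / (real b * (1 - \<beta>))) / N = R"
      unfolding R_def gap N_def[symmetric]
      by (rule hsgd_rate_eq) (use b(1) N beta_eq gamma_eq in \<open>auto simp: N_def\<close>)
    finally show ?thesis .
  qed
  then have I_le_R: "I \<le> R" using \<open>R \<ge> 0\<close> by simp
  have part_c: "I \<le> \<Delta>0 / (real m + 1) powr (2/3) \<and>
        (\<forall>\<epsilon>>0.
          (int m = \<lfloor>\<Delta>0 powr (3/2) / \<epsilon> ^ 3\<rfloor> \<longrightarrow> I \<le> \<epsilon>\<^sup>2 \<and>
             (\<forall>\<omega>. int (prox_calls (run \<omega> m)) - int (prox_calls (run \<omega> 0))
                    = \<lfloor>\<Delta>0 powr (3/2) / \<epsilon> ^ 3\<rfloor>)) \<and>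
          (int m + 1 = \<lfloor>\<Delta>0 powr (3/2) / \<epsilon> ^ 3\<rfloor> \<longrightarrow> I \<le> \<epsilon>\<^sup>2 \<and>
             (\<forall>\<omega>. int (prox_calls (run \<omega> m)) = \<lfloor>\<Delta>0 powr (3/2) / \<epsilon> ^ 3\<rfloor> \<and>
                  int (grad_calls (run \<omega> m))
                    \<le> \<lfloor>c1\<^sup>2 * \<Delta>0 powr (1/2) / \<epsilon> + 3 * \<Delta>0 powr (3/2) / \<epsilon> ^ 3\<rfloor>)))"
    if c1: "c1 \<ge> 1 / (real m + 1) powr (2/3)" and b_eq: "real b = c1\<^sup>2 * (real m + 1) powr (1/3)"
      and \<Delta>0: "\<Delta>0 = 16 * sqrt (13 * c1) * L / 3 * Fgap + 208 * \<sigma>\<^sup>2 / (9 * c1)" for c1 \<Delta>0 :: real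
  proof -
    have "0 < 1 / (real m + 1) powr (2/3)" by simp
    with c1 have "c1 > 0" by linarith
    have "\<Delta>0 \<ge> 0" using gap_nonneg L_pos \<open>c1 > 0\<close> by (simp add: \<Delta>0)
    have R_eq: "R = \<Delta>0 / N powr (2/3)"
      unfolding R_def \<Delta>0 using hsgd_rate_batch_eq[of N c1 "real b" L Fgap \<sigma>] N \<open>c1 > 0\<close> b_eq
      by (simp add: N_def)
    \<comment> \<open>Here the floor gives \<Delta>0^(3/2) / \<epsilon>^3 < m + 1, so the bound R of
      part (b) is enough.\<close>
    have small: "I \<le> \<epsilon>\<^sup>2" if "\<epsilon> > 0" "int m = \<lfloor>\<Delta>0 powr (3/2) / \<epsilon> ^ 3\<rfloor>" for \<epsilon>
    proof -
      have "\<Delta>0 powr (3/2) / \<epsilon> ^ 3 \<le> N"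
        using that(2) unfolding N_def by linarith
      with \<open>\<Delta>0 \<ge> 0\<close> \<open>\<epsilon> > 0\<close> have "\<Delta>0 \<le> N powr (2/3) * \<epsilon>\<^sup>2" by (rule le_powr_two_thirds)
      then have "R \<le> \<epsilon>\<^sup>2" using N by (simp add: R_eq pos_divide_le_eq mult.commute)
      with I_le_R show ?thesis by linarith
    qed
    \<comment> \<open>Now the floor gives only \<Delta>0^(3/2) / \<epsilon>^3 < m + 2, so R may
      exceed \<epsilon>^2 by the factor ((m + 2) / (m + 1))^(2/3). The 5/7 in \<open>I_le\<close>
      makes up for it when m >= 1.\<close>
    have small': "I \<le> \<epsilon>\<^sup>2" if "\<epsilon> > 0" "int m + 1 = \<lfloor>\<Delta>0 powr (3/2) / \<epsilon> ^ 3\<rfloor>" for \<epsilon>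
    proof -
      have "\<Delta>0 powr (3/2) / \<epsilon> ^ 3 \<le> N + 1"
        using that(2) unfolding N_def by linarith
      with \<open>\<Delta>0 \<ge> 0\<close> \<open>\<epsilon> > 0\<close> have \<Delta>_le: "\<Delta>0 \<le> (N + 1) powr (2/3) * \<epsilon>\<^sup>2" by (rule le_powr_two_thirds)
      have root: "x powr (2/3) \<le> y" if "x\<^sup>2 \<le> y ^ 3" "0 < x" "0 < y" for x y :: real
      proof -
        have "x powr (2/3) = (x\<^sup>2) powr (1/3)"
          using that(2) powr_powr[of x 2 "1/3"] by simp
        also have "\<dots> \<le> (y ^ 3) powr (1/3)" using that(1) by (intro powr_mono2) auto
        also have "\<dots> = y" using that(3) powr_powr[of y 3 "1/3"] by simp
        finally show ?thesis .
      qed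
      show ?thesis
      \<comment> \<open>At m = 0 the factor 2^(2/3) exceeds 7/5. But then the output is
        \<open>x0\<close>, b = c1^2 forces c1 >= 1, and \<open>gmap_x0_le\<close> bounds the
        expectation by \<Delta>0 / 2, which is enough since 2^(2/3) <= 2.\<close>
      proof (cases "m = 0")
        case True
        have "N = 1" using True by (simp add: N_def)
        interpret Q: prob_space Q by (rule prob_space_Q)
        have "{..m} = {0}" using True by auto
        then have "I = (norm (gmap x0))\<^sup>2" unfolding I_eq \<open>N = 1\<close> by (simp add: xs_0 Q.prob_space)
        also have "\<dots> \<le> 8 / 3 * L * Fgap" unfolding gap by (rule gmap_x0_le)
        also have "\<dots> \<le> 1 / 2 * \<Delta>0"
        proof -
          have "c1\<^sup>2 \<ge> 1" using b_eq b(1) True by simp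
          then have "c1 \<ge> 1" using \<open>c1 > 0\<close> by (simp add: power2_ge_1_iff abs_if)
          then have "sqrt (13 * c1) \<ge> 1" by simp
          then have "16 * 1 * L / 3 * Fgap \<le> 16 * sqrt (13 * c1) * L / 3 * Fgap"
            using gap_nonneg L_pos by (intro mult_right_mono divide_right_mono mult_left_mono) auto
          moreover have "0 \<le> 208 * \<sigma>\<^sup>2 / (9 * c1)" using \<open>c1 > 0\<close> by simp
          ultimately have "16 * 1 * L / 3 * Fgap \<le> \<Delta>0" unfolding \<Delta>0 by linarith
          then show ?thesis by simp
        qed
        also have "\<dots> \<le> 1 / 2 * (2 * \<epsilon>\<^sup>2)"
        proof -
          have "(N + 1) powr (2/3) * \<epsilon>\<^sup>2 \<le> 2 * \<epsilon>\<^sup>2"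
            using \<open>N = 1\<close> by (intro mult_right_mono root) auto
          with \<Delta>_le show ?thesis by simp
        qed
        finally show ?thesis by simp
      next
        case False
        then have "N \<ge> 2" by (simp add: N_def)
        \<comment> \<open>For N >= 2 the ratio is at most 3/2, and (3/2)^2 = 2.25 lies below (7/5)^3
          = 2.744.\<close>
        have "((N + 1) / N) powr (2/3) \<le> 7 / 5"
        proof (rule root)
          have "(N + 1) / N \<le> 3 / 2" using \<open>N \<ge> 2\<close> by (simp add: field_simps)
          then have "((N + 1) / N)\<^sup>2 \<le> (3 / 2)\<^sup>2" using \<open>N \<ge> 2\<close> by (intro power_mono) auto
          then show "((N + 1) / N)\<^sup>2 \<le> (7 / 5) ^ 3" by (simp add: power_divide)
        qed (use \<open>N \<ge> 2\<close> in auto)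
        then have "(N + 1) powr (2/3) \<le> 7 / 5 * N powr (2/3)"
          using \<open>N \<ge> 2\<close> by (simp add: powr_divide pos_divide_le_eq)
        then have "(N + 1) powr (2/3) * \<epsilon>\<^sup>2 \<le> 7 / 5 * N powr (2/3) * \<epsilon>\<^sup>2"
          by (rule mult_right_mono) simp
        with \<Delta>_le have "\<Delta>0 \<le> 7 / 5 * \<epsilon>\<^sup>2 * N powr (2/3)" by (simp add: mult_ac)
        then have "R \<le> 7 / 5 * \<epsilon>\<^sup>2" using N by (simp add: R_eq pos_divide_le_eq)
        with I_le show ?thesis by linarith
      qed
    qed
    \<comment> \<open>From m + 1 <= K with K = \<Delta>0^(3/2) / \<epsilon>^3, the batch size c1^2
      (m + 1)^(1/3) is at most c1^2 K^(1/3) = c1^2 \<Delta>0^(1/2) / \<epsilon>. The count is an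
      integer, so its bound passes to the floor.\<close>
    have calls: "b + 3 * m \<le> \<lfloor>c1\<^sup>2 * \<Delta>0 powr (1/2) / \<epsilon> + 3 * \<Delta>0 powr (3/2) / \<epsilon> ^ 3\<rfloor>"
      if "\<epsilon> > 0" "int m + 1 = \<lfloor>\<Delta>0 powr (3/2) / \<epsilon> ^ 3\<rfloor>" for \<epsilon>
    proof -
      let ?K = "\<Delta>0 powr (3/2) / \<epsilon> ^ 3"
      have NK: "N \<le> ?K" using that(2) unfolding N_def by linarith
      have "N powr (1/3) \<le> ?K powr (1/3)" using NK N by (intro powr_mono2) auto
      also have "?K powr (1/3) = (\<Delta>0 powr (3/2)) powr (1/3) / (\<epsilon> powr 3) powr (1/3)"
        using \<open>\<epsilon> > 0\<close> by (simp add: powr_divide)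
      also have "\<dots> = \<Delta>0 powr (1/2) / \<epsilon>"
        using \<open>\<epsilon> > 0\<close> by (simp only: powr_powr) simp
      finally have "c1\<^sup>2 * N powr (1/3) \<le> c1\<^sup>2 * (\<Delta>0 powr (1/2) / \<epsilon>)" by (rule mult_left_mono) simp
      then have "real b \<le> c1\<^sup>2 * \<Delta>0 powr (1/2) / \<epsilon>" by (simp add: b_eq N_def)
      moreover have "3 * real m \<le> 3 * \<Delta>0 powr (3/2) / \<epsilon> ^ 3" using NK by (simp add: N_def)
      ultimately show ?thesis by (simp add: le_floor_iff)
    qed
    show ?thesis
      using I_le_R small small' calls
      by (auto simp: R_eq N_def run_eq prox_calls_proxHSGD grad_calls_proxHSGD)
  qed
  show ?thesis
    unfolding I_def[symmetric] R_def[symmetric]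
    by (rule conjI, (use \<beta>_strict \<gamma>_strict \<eta>_bounds in simp), rule conjI,
        (use int I_le_R in simp), intro allI impI, elim conjE, rule part_c)
qed

end
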